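(* For every (fixed) real number $c>0$ we have $$e_c(t)=\frac{(\log(1/t))^{c-1}}{\Gamma(c)}+\mathcal O\big((\log(1/t))^{c-2}\big),\qquad t\to 0,\ t>0.$$
   Context: For $c>0$ the function $e_c:(0,\infty)\to\mathbb R$ is defined by $$e_c(t)=\frac{1}{2\pi}\int_{-\infty}^{\infty} t^{ix-1}\,\Gamma(1-ix)^c\,dx,\qquad t>0,$$ where $\Gamma(z)^c=\exp(c\log\Gamma(z))$ for $z\in\mathbb C\setminus(-\infty,0]$, and $\log\Gamma$ denotes the holomorphic branch on $\mathbb C\setminus(-\infty,0]$ of the logarithm of the (non-vanishing) function $\Gamma$ that equals $0$ at $z=1$. It is known that $e_c$ is a probability density on $(0,\infty)$. *)

theory Defs
  imports "HOL-Analysis.Analysis" "HOL-Library.Landau_Symbols"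
begin

section \<open>Complex powers of the Gamma function\<close>

text \<open>
  On the complex numbers, \<^const>\<open>ln_Gamma\<close> is defined as the limit of an explicit sequence. On the
  plane cut along \<open>(-\<infinity>, 0]\<close> it is the unique holomorphic branch of the logarithm of
  \<^const>\<open>Gamma\<close> that vanishes at 1.
\<close>

lemma ln_Gamma_branch:
  shows "ln_Gamma holomorphic_on (- \<real>\<^sub>\<le>\<^sub>0 :: complex set)"
    and "\<And>z :: complex. z \<notin> \<real>\<^sub>\<le>\<^sub>0 \<Longrightarrow> exp (ln_Gamma z) = Gamma z"
    and "ln_Gamma (1 :: complex) = 0"
proof -
  show "ln_Gamma holomorphic_on (- \<real>\<^sub>\<le>\<^sub>0 :: complex set)"
    by (rule holomorphic_ln_Gamma) auto
  show "exp (ln_Gamma z) = Gamma z" if "z \<notin> \<real>\<^sub>\<le>\<^sub>0" for z :: complex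
    using that nonpos_Ints_subset_nonpos_Reals by (auto simp: Gamma_complex_altdef)
  have "Gamma (1 :: real) = exp (ln_Gamma 1)"
    by (rule Gamma_real_pos_exp) simp
  hence "ln_Gamma (1 :: real) = 0"
    by simp
  thus "ln_Gamma (1 :: complex) = 0"
    using ln_Gamma_complex_of_real[of 1] by simp
qed

lemma ln_Gamma_branch_unique:
  fixes L :: "complex \<Rightarrow> complex"
  assumes holo: "L holomorphic_on - \<real>\<^sub>\<le>\<^sub>0"
    and expL: "\<And>z. z \<notin> \<real>\<^sub>\<le>\<^sub>0 \<Longrightarrow> exp (L z) = Gamma z"
    and L1: "L 1 = 0"
    and z: "z \<notin> \<real>\<^sub>\<le>\<^sub>0"
  shows "L z = ln_Gamma z"
proof -
  define D where "D = (\<lambda>z. L z - ln_Gamma z)"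
  have op: "open (- \<real>\<^sub>\<le>\<^sub>0 :: complex set)"
    by (simp add: open_Compl)
  have hD: "D holomorphic_on - \<real>\<^sub>\<le>\<^sub>0"
    unfolding D_def by (intro holomorphic_on_diff holo ln_Gamma_branch(1))
  have e1: "exp (D w) = 1" if "w \<notin> \<real>\<^sub>\<le>\<^sub>0" for w
    using that by (simp add: D_def exp_diff expL flip: ln_Gamma_branch(2))
  have dD: "(D has_field_derivative 0) (at w)" if w: "w \<notin> \<real>\<^sub>\<le>\<^sub>0" for w
  proof -
    obtain d where d: "(D has_field_derivative d) (at w)"
      using hD op w by (metis ComplI holomorphic_on_open)
    have "((\<lambda>w. exp (D w)) has_field_derivative exp (D w) * d) (at w)"
      by (rule DERIV_fun_exp[OF d])
    moreover have "((\<lambda>w. exp (D w)) has_field_derivative 0) (at w)"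
      by (rule has_field_derivative_transform_within_open[where f = "\<lambda>_. 1" and S = "- \<real>\<^sub>\<le>\<^sub>0"])
         (use w op e1 in auto)
    ultimately have "exp (D w) * d = 0"
      by (rule DERIV_unique)
    thus ?thesis using d by simp
  qed
  have "- \<real>\<^sub>\<le>\<^sub>0 = - (complex_of_real ` {..0})"
    by (auto simp: nonpos_Reals_def)
  hence "starlike (- \<real>\<^sub>\<le>\<^sub>0 :: complex set)"
    using starlike_slotted_complex_plane_left[of 0] by simp
  hence con: "connected (- \<real>\<^sub>\<le>\<^sub>0 :: complex set)"
    by (rule starlike_imp_connected)
  obtain c where c: "\<And>w. w \<in> - \<real>\<^sub>\<le>\<^sub>0 \<Longrightarrow> D w = c"
    using DERIV_zero_connected_constant[OF con op finite.emptyI, of D]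
          holomorphic_on_imp_continuous_on[OF hD] dD by auto
  have "D 1 = 0"
    by (simp add: D_def L1 ln_Gamma_branch(3))
  with c[of 1] c[of z] z have "D z = 0"
    by auto
  thus ?thesis by (simp add: D_def)
qed

definition Gamma_powr :: "complex \<Rightarrow> real \<Rightarrow> complex" where
  "Gamma_powr z c = exp (of_real c * ln_Gamma z)"


section \<open>The function \<open>e\<^sub>c\<close>\<close>

definition e_integrand :: "real \<Rightarrow> real \<Rightarrow> real \<Rightarrow> complex" where
  "e_integrand c t x = of_real t powr (\<i> * of_real x - 1) * Gamma_powr (1 - \<i> * of_real x) c"

text \<open>
  The integral is a real number; this is recorded in \<open>of_real_e_fun\<close> below, so \<^const>\<open>Re\<close> only changes
  the type. It converges absolutely by \<open>integrable_e_integrand\<close>.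
\<close>

definition e_fun :: "real \<Rightarrow> real \<Rightarrow> real" where
  "e_fun c t = Re (1 / (2 * of_real pi) * (CLBINT x. e_integrand c t x))"

lemma ln_Gamma_cnj:
  fixes z :: complex
  assumes z: "z \<notin> \<real>\<^sub>\<le>\<^sub>0"
  shows "ln_Gamma (cnj z) = cnj (ln_Gamma z)"
proof -
  define L where "L = cnj \<circ> ln_Gamma \<circ> cnj"
  have cn: "cnj w \<notin> \<real>\<^sub>\<le>\<^sub>0" if "w \<notin> \<real>\<^sub>\<le>\<^sub>0" for w
    using that by (auto simp: complex_nonpos_Reals_iff)
  have im: "cnj ` (- \<real>\<^sub>\<le>\<^sub>0) = - \<real>\<^sub>\<le>\<^sub>0"
    using cn by (fastforce simp: image_iff intro: bexI[of _ "cnj x" for x])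
  have "L holomorphic_on - \<real>\<^sub>\<le>\<^sub>0"
    unfolding L_def
    by (subst holomorphic_on_compose_cnj_cnj) (auto simp: im open_Compl intro: ln_Gamma_branch)
  moreover have "exp (L w) = Gamma w" if "w \<notin> \<real>\<^sub>\<le>\<^sub>0" for w
    using ln_Gamma_branch(2)[OF cn[OF that]] by (simp add: L_def cnj_Gamma flip: exp_cnj)
  moreover have "L 1 = 0"
    by (simp add: L_def ln_Gamma_branch)
  ultimately have "L (cnj z) = ln_Gamma (cnj z)"
    using cn[OF z] by (intro ln_Gamma_branch_unique) auto
  thus ?thesis by (simp add: L_def)
qed

lemma one_minus_ii_notin: "1 - \<i> * of_real x \<notin> \<real>\<^sub>\<le>\<^sub>0"
  by (auto simp: complex_nonpos_Reals_iff)

lemma of_real_e_fun: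
  assumes "t > 0"
  shows "of_real (e_fun c t) = 1 / (2 * of_real pi) * (CLBINT x. e_integrand c t x)"
proof -
  have "cnj (e_integrand c t x) = e_integrand c t (- x)" for x
  proof -
    have "ln_Gamma (1 + \<i> * of_real x) = cnj (ln_Gamma (1 - \<i> * of_real x))"
      using ln_Gamma_cnj[OF one_minus_ii_notin[of x]] by simp
    thus ?thesis
      using assms by (simp add: e_integrand_def Gamma_powr_def powr_def Ln_of_real exp_cnj)
  qed
  hence "cnj (CLBINT x. e_integrand c t x) = (CLBINT x. e_integrand c t (- x))"
    by (simp flip: Bochner_Integration.integral_cnj)
  also have "\<dots> = (CLBINT x. e_integrand c t x)"
    using lborel_integral_real_affine[of "-1" "e_integrand c t" 0] by simp
  finally have "(CLBINT x. e_integrand c t x) \<in> \<real>"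
    by (simp add: Reals_cnj_iff)
  hence "1 / (2 * of_real pi) * (CLBINT x. e_integrand c t x) \<in> \<real>"
    by auto
  thus ?thesis
    unfolding e_fun_def by (rule of_real_Re)
qed

lemma norm_Gamma_one_minus_ii_le:
  "norm (Gamma (1 - \<i> * of_real x)) ^ 2 \<le> 2 * exp (- \<bar>x\<bar>)"
proof (cases "x = 0")
  case False
  define y where "y = pi * \<bar>x\<bar>"
  have y: "y > 0" using False by (simp add: y_def)
  have ix: "\<i> * of_real x \<notin> \<int>\<^sub>\<le>\<^sub>0"
    using False by (auto elim!: nonpos_Ints_cases simp: complex_eq_iff)
  have "of_real (norm (Gamma (1 - \<i> * of_real x)) ^ 2)
          = Gamma (1 - \<i> * of_real x) * cnj (Gamma (1 - \<i> * of_real x))"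
    by (rule complex_norm_square)
  also have "cnj (Gamma (1 - \<i> * of_real x)) = Gamma (\<i> * of_real x + 1)"
    by (simp add: add.commute cnj_Gamma)
  also have "\<dots> = \<i> * of_real x * Gamma (\<i> * of_real x)"
    by (rule Gamma_plus1[OF ix])
  also have "Gamma (1 - \<i> * of_real x) * (\<i> * of_real x * Gamma (\<i> * of_real x))
               = \<i> * of_real x * (Gamma (\<i> * of_real x) * Gamma (1 - \<i> * of_real x))"
    by (simp add: mult_ac)
  also have "\<dots> = \<i> * of_real x * (of_real pi / sin (of_real pi * (\<i> * of_real x)))"
    by (subst Gamma_reflection_complex) auto
  finally have "norm (of_real (norm (Gamma (1 - \<i> * of_real x)) ^ 2) :: complex)
      = norm (\<i> * of_real x * (of_real pi / sin (of_real pi * (\<i> * of_real x))))"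
    by (rule arg_cong)
  moreover have "norm (sin (of_real pi * (\<i> * of_real x))) = sinh y"
  proof -
    have "\<i> * of_real (pi * x) = of_real pi * (\<i> * of_real x)"
      by simp
    hence "norm (sin (of_real pi * (\<i> * of_real x))) = norm (sinh (of_real (pi * x) :: complex))"
      by (simp only: sinh_conv_sin norm_mult) simp
    also have "sinh (of_real (pi * x) :: complex) = of_real (sinh (pi * x))"
      by (simp add: sinh_field_def exp_of_real del: of_real_mult flip: of_real_minus)
    also have "norm (of_real (sinh (pi * x)) :: complex) = sinh y"
      by (simp add: y_def abs_mult flip: sinh_real_abs)
    finally show ?thesis .
  qed
  ultimately have eq: "norm (Gamma (1 - \<i> * of_real x)) ^ 2 = y / sinh y"
    by (simp add: norm_mult norm_divide y_def power2_eq_square mult_ac)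
  have "y \<le> 2 * exp (- \<bar>x\<bar>) * sinh y"
  proof -
    have "2 * \<bar>x\<bar> \<le> pi * \<bar>x\<bar>"
      by (intro mult_right_mono) (use pi_ge_two in auto)
    hence "exp \<bar>x\<bar> / 2 \<le> exp (y / 2) / 2"
      by (simp add: y_def)
    also have "\<dots> \<le> cosh (y / 2)"
      by (simp add: cosh_field_def)
    finally have "(y / 2) * (exp \<bar>x\<bar> / 2) \<le> sinh (y / 2) * cosh (y / 2)"
      using real_le_x_sinh[of "y / 2"] y
      by (intro mult_mono) (auto simp: sinh_field_def exp_minus)
    also have "\<dots> = sinh y / 2"
      using sinh_double[of "y / 2"] by simp
    finally have "y * exp \<bar>x\<bar> \<le> 2 * sinh y"
      by simp
    thus ?thesis
      by (simp add: exp_minus field_simps)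
  qed
  thus ?thesis using y by (simp add: eq field_simps)
qed simp

lemma norm_e_integrand:
  assumes "t > 0"
  shows "norm (e_integrand c t x) = norm (Gamma (1 - \<i> * of_real x)) powr c / t"
proof -
  have "norm (Gamma_powr z c) = norm (Gamma z) powr c" if "z \<notin> \<real>\<^sub>\<le>\<^sub>0" for z
    by (simp add: Gamma_powr_def powr_def flip: ln_Gamma_branch(2)[OF that])
  from this[OF one_minus_ii_notin] show ?thesis
    using assms by (simp add: e_integrand_def norm_mult norm_powr_real_powr powr_minus_divide)
qed

lemma integrable_exp_minus_abs:
  assumes "(a :: real) > 0"
  shows "integrable lborel (\<lambda>x. exp (- a * \<bar>x\<bar>))"
proof -
  have "(\<lambda>x. exp (- a * x)) absolutely_integrable_on {0..}"
    by (intro nonnegative_absolutely_integrable_1 integrable_on_exp_minus_to_infinity assms) auto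
  hence "integrable lborel (\<lambda>x. indicator {0..} x *\<^sub>R exp (- a * x))"
    unfolding set_integrable_def by (subst (asm) integrable_completion) auto
  also have "(\<lambda>x. indicator {0..} x *\<^sub>R exp (- a * x)) = (\<lambda>x. indicator {0..} x *\<^sub>R exp (- a * \<bar>x\<bar>))"
    by (auto simp: indicator_def)
  finally obtain I where
    "has_bochner_integral lborel (\<lambda>x. indicator {0..} x *\<^sub>R exp (- a * \<bar>x\<bar>)) I"
    by (auto simp: integrable.simps)
  from has_bochner_integral_even_function[OF this] show ?thesis
    by (auto simp: integrable.simps)
qed

lemma integrable_e_integrand:
  assumes c: "c > 0" and t: "t > 0"
  shows "integrable lborel (e_integrand c t)"
proof (rule Bochner_Integration.integrable_bound)
  show "integrable lborel (\<lambda>x. 2 powr (c / 2) / t * exp (- (c / 2) * \<bar>x\<bar>))"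
    using c by (intro integrable_mult_right integrable_exp_minus_abs) auto
  have "continuous_on UNIV (\<lambda>x. e_integrand c t x)"
    unfolding e_integrand_def Gamma_powr_def using t
    by (intro continuous_intros continuous_on_compose2[OF continuous_on_ln_Gamma_complex[of "- \<real>\<^sub>\<le>\<^sub>0"]])
       (auto simp: complex_nonpos_Reals_iff)
  thus "e_integrand c t \<in> borel_measurable lborel"
    using borel_measurable_continuous_onI by auto
  have "norm (e_integrand c t x) \<le> norm (2 powr (c / 2) / t * exp (- (c / 2) * \<bar>x\<bar>))" for x
  proof -
    let ?N = "norm (Gamma (1 - \<i> * of_real x))"
    have "?N powr c = (?N ^ 2) powr (c / 2)"
      by (simp add: powr_powr flip: powr_numeral)
    also have "\<dots> \<le> (2 * exp (- \<bar>x\<bar>)) powr (c / 2)"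
      using c by (intro powr_mono2 norm_Gamma_one_minus_ii_le) auto
    also have "\<dots> = 2 powr (c / 2) * exp (- (c / 2) * \<bar>x\<bar>)"
      by (simp add: powr_mult exp_powr_real mult_ac)
    finally show ?thesis
      using t by (simp add: norm_e_integrand divide_right_mono)
  qed
  thus "AE x in lborel. norm (e_integrand c t x) \<le> norm (2 powr (c / 2) / t * exp (- (c / 2) * \<bar>x\<bar>))"
    by simp
qed

end

theory Submission
  imports Defs "HOL-Complex_Analysis.Cauchy_Integral_Formula" "HOL-Probability.Sinc_Integral"
begin

text \<open>
  With \<open>L = ln (1 / t)\<close> and \<open>z = 1 - \<i> x\<close>, the number \<open>e\<^sub>c(t)\<close> is the inverse Laplace integral of
  \<open>F(z) = \<Gamma>(z)\<^sup>c\<close> at \<open>L\<close>, taken over the line \<open>Re z = 1\<close>. Move the line to \<open>Re z = 1 / L\<close>, where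
  \<open>exp (L z)\<close> is bounded, and integrate by parts twice: \<open>L\<^sup>2\<close> times the integral of \<open>exp (L z) F(z)\<close> is
  the integral of \<open>exp (L z) F''(z)\<close>. Since \<open>F(z) = z powr -c * G(z)\<close> with \<open>G(z) = \<Gamma>(1 + z)\<^sup>c\<close> and
  \<open>G(0) = 1\<close>, we have \<open>F''(z) = c (c + 1) z powr -(c + 2) + O(\<bar>z\<bar> powr -(c + 1))\<close> uniformly on the strip
  \<open>0 < Re z \<le> 1\<close>. Both exponents are below \<open>-1\<close>, so rescaling \<open>z\<close> by \<open>L\<close> gives the main term
  \<open>L\<^sup>2 L powr (c - 1) / \<Gamma>(c)\<close> and the error \<open>O(L powr c)\<close>. No Hankel contour is needed; the constant
  \<open>1 / \<Gamma>(c + 2)\<close> comes from a Laplace transform in \<open>L\<close> and the Poisson formula for a half-plane.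
\<close>

section \<open>Integrals along vertical lines\<close>

text \<open>The fundamental theorem of calculus over the whole line. It serves twice: for moving the
  line of integration and for integrating by parts.\<close>

lemma integral_deriv_eq_0:
  fixes f :: "real \<Rightarrow> complex"
  assumes der: "\<And>y. (f has_vector_derivative f' y) (at y)"
    and cont: "continuous_on UNIV f'" and int: "integrable lborel f'"
    and top: "(f \<longlongrightarrow> 0) at_top" and bot: "(f \<longlongrightarrow> 0) at_bot"
  shows "(LBINT y. f' y) = 0"
proof -
  have "(LBINT y=-\<infinity>..\<infinity>. f' y) = 0 - 0"
  proof (rule interval_integral_FTC_integrable)
    show "isCont f' y" for y
      using cont by (simp add: continuous_on_eq_continuous_at)
    show "set_integrable lborel (einterval (- \<infinity>) \<infinity>) f'"
      using int by (simp add: set_integrable_def einterval_eq_UNIV)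
  qed (use der top bot in \<open>auto simp: ereal_tendsto_simps\<close>)
  thus ?thesis
    by (simp add: interval_lebesgue_integral_def set_lebesgue_integral_def einterval_eq_UNIV)
qed

lemma integrable_inverse_one_plus_square: "integrable lborel (\<lambda>y::real. B / (1 + y\<^sup>2))"
proof -
  have "integrable lborel (\<lambda>y::real. B * inverse (1 + y\<^sup>2))"
    using integrable_inverse_1_plus_square
    by (intro integrable_mult_right) (simp add: set_integrable_def einterval_eq_UNIV)
  thus ?thesis by (simp add: field_simps)
qed

lemma integral_inverse_one_plus_square: "(LBINT y::real. B / (1 + y\<^sup>2)) = B * pi"
proof -
  have "(LBINT y::real. B * inverse (1 + y\<^sup>2)) = B * pi"
    using LBINT_inverse_1_plus_square
    by (simp add: interval_lebesgue_integral_def set_lebesgue_integral_def einterval_eq_UNIV)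
  thus ?thesis by (simp add: field_simps)
qed

lemma integrable_if_dominated:
  fixes f :: "real \<Rightarrow> complex"
  assumes "continuous_on UNIV f" and "integrable lborel g" and "\<And>y. norm (f y) \<le> g y"
  shows "integrable lborel f"
proof (rule Bochner_Integration.integrable_bound[OF assms(2)])
  show "f \<in> borel_measurable lborel"
    using borel_measurable_continuous_onI[OF assms(1)] by simp
  show "AE y in lborel. norm (f y) \<le> norm (g y)"
    using assms(3) by (intro always_eventually allI) (metis abs_ge_self order_trans real_norm_def)
qed

lemma inverse_one_plus_square_tendsto_0:
  "((\<lambda>y::real. B / (1 + y\<^sup>2)) \<longlongrightarrow> 0) at_top" "((\<lambda>y::real. B / (1 + y\<^sup>2)) \<longlongrightarrow> 0) at_bot"
proof -
  have "((\<lambda>y::real. 1 / (1 + y\<^sup>2)) \<longlongrightarrow> 0) at_top" "((\<lambda>y::real. 1 / (1 + y\<^sup>2)) \<longlongrightarrow> 0) at_bot"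
    by real_asymp+
  from this[THEN tendsto_mult_right_zero[where c = B]] show
    "((\<lambda>y::real. B / (1 + y\<^sup>2)) \<longlongrightarrow> 0) at_top" "((\<lambda>y::real. B / (1 + y\<^sup>2)) \<longlongrightarrow> 0) at_bot"
    by simp_all
qed

lemma continuous_on_vertical_line:
  assumes "continuous_on {z. Re z > 0} f" "s > 0"
  shows "continuous_on UNIV (\<lambda>y. f (Complex s y))"
proof (rule continuous_on_compose2[OF assms(1)])
  show "continuous_on UNIV (Complex s)"
    unfolding Complex_eq by (intro continuous_intros)
qed (use assms in auto)

lemma has_vector_derivative_vertical_line:
  assumes "(f has_field_derivative d) (at (Complex s y))"
  shows "((\<lambda>y. f (Complex s y)) has_vector_derivative \<i> * d) (at y)"
proof -
  have "(Complex s has_vector_derivative \<i>) (at y)"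
    unfolding Complex_eq by (auto intro!: derivative_eq_intros simp: has_vector_derivative_def scaleR_conv_of_real)
  from field_vector_diff_chain_at[OF this assms] show ?thesis
    by (simp add: o_def)
qed

text \<open>The half-plane is convex, so \<open>P\<close> has a primitive \<open>Q\<close> there.
  The difference \<open>H\<close> of \<open>Q\<close> between the two lines is the integral of
  \<open>P\<close> over a horizontal segment, hence at most its length times the bound on
  \<open>P\<close>, and vanishes at both ends. Its derivative is \<open>\<i>\<close> times the
  difference of the two integrands, so the two integrals agree.\<close>

lemma integral_vertical_line_shift:
  fixes P :: "complex \<Rightarrow> complex"
  assumes hol: "P holomorphic_on {z. Re z > 0}" and st: "0 < s" "s \<le> t"
    and bd: "\<And>x y. s \<le> x \<Longrightarrow> x \<le> t \<Longrightarrow> norm (P (Complex x y)) \<le> B / (1 + y\<^sup>2)"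
  shows "(CLBINT y. P (Complex s y)) = (CLBINT y. P (Complex t y))"
proof -
  have op: "open {z. Re z > 0}" and co: "convex {z. Re z > 0}"
    by (rule open_halfspace_Re_gt convex_halfspace_Re_gt)+
  obtain Q where Q0: "\<And>z. z \<in> {z. Re z > 0} \<Longrightarrow> (Q has_field_derivative P z) (at z within {z. Re z > 0})"
    using holomorphic_convex_primitive'[OF co op hol] by blast
  hence Q: "(Q has_field_derivative P z) (at z)" if "Re z > 0" for z
    using Q0[of z] that by (simp add: at_within_open[OF _ op])
  define H where "H = (\<lambda>y. Q (Complex t y) - Q (Complex s y))"
  have cont: "continuous_on UNIV (\<lambda>y. P (Complex x y))" if "x > 0" for x
    by (intro continuous_on_vertical_line holomorphic_on_imp_continuous_on hol that)
  have int: "integrable lborel (\<lambda>y. P (Complex x y))" if "s \<le> x" "x \<le> t" for x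
    using that st
    by (intro integrable_if_dominated[OF cont integrable_inverse_one_plus_square bd]) auto
  have Hbd: "norm (H y) \<le> B * (t - s) / (1 + y\<^sup>2)" for y
  proof -
    define S where "S = closed_segment (Complex s y) (Complex t y)"
    have S: "s \<le> Re z \<and> Re z \<le> t \<and> Im z = y" if z: "z \<in> S" for z
    proof -
      obtain u where u: "0 \<le> u" "u \<le> 1" "z = (1 - u) *\<^sub>R Complex s y + u *\<^sub>R Complex t y"
        using z unfolding S_def in_segment by blast
      have "Re z = s + u * (t - s)" "Im z = y"
        by (simp_all add: u algebra_simps)
      moreover have "u * (t - s) \<le> 1 * (t - s)" "0 \<le> u * (t - s)"
        using u st by (intro mult_right_mono mult_nonneg_nonneg; simp)+
      ultimately show ?thesis by auto
    qed
    have "norm (Q (Complex t y) - Q (Complex s y)) \<le> B / (1 + y\<^sup>2) * norm (Complex t y - Complex s y)"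
    proof (rule field_differentiable_bound[of S])
      show "(Q has_field_derivative P z) (at z within S)" if "z \<in> S" for z
        using S[OF that] st by (intro has_field_derivative_at_within[OF Q]) auto
      show "norm (P z) \<le> B / (1 + y\<^sup>2)" if "z \<in> S" for z
        using S[OF that] bd[of "Re z" y] by (metis complex_surj)
    qed (auto simp: S_def)
    also have "norm (Complex t y - Complex s y) = t - s"
      using st by (simp add: cmod_def)
    finally show ?thesis by (simp add: H_def)
  qed
  have "(CLBINT y. \<i> * P (Complex t y) - \<i> * P (Complex s y)) = 0"
  proof (rule integral_deriv_eq_0)
    show "(H has_vector_derivative \<i> * P (Complex t y) - \<i> * P (Complex s y)) (at y)" for y
      unfolding H_def using st
      by (intro has_vector_derivative_diff has_vector_derivative_vertical_line Q) auto
    show "continuous_on UNIV (\<lambda>y. \<i> * P (Complex t y) - \<i> * P (Complex s y))"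
      using st by (intro continuous_intros cont) auto
    show "integrable lborel (\<lambda>y. \<i> * P (Complex t y) - \<i> * P (Complex s y))"
      using st by (intro Bochner_Integration.integrable_diff integrable_mult_right int) auto
    show "(H \<longlongrightarrow> 0) at_top" "(H \<longlongrightarrow> 0) at_bot"
      by (rule Lim_null_comparison[where g = "\<lambda>y. B * (t - s) / (1 + y\<^sup>2)"],
          rule always_eventually, rule allI, rule Hbd, rule inverse_one_plus_square_tendsto_0)+
  qed
  also have "(CLBINT y. \<i> * P (Complex t y) - \<i> * P (Complex s y)) =
      \<i> * ((CLBINT y. P (Complex t y)) - (CLBINT y. P (Complex s y)))"
    using st int by (simp add: right_diff_distrib)
  finally show ?thesis by simp
qed

section \<open>The inverse Laplace transform of a power\<close>

lemma norm_Complex_ge: "s \<le> norm (Complex s y)" "\<bar>y\<bar> \<le> norm (Complex s y)"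
  using complex_Re_le_cmod[of "Complex s y"] abs_Im_le_cmod[of "Complex s y"] by simp_all

lemma norm_powr_minus: "norm (z powr - complex_of_real a) = norm z powr - a"
  by (metis norm_powr_real_powr' Reals_of_real of_real_minus Re_complex_of_real)

lemma holomorphic_powr_right_half_plane: "(\<lambda>z. z powr s) holomorphic_on {z. Re z > 0}"
proof (subst holomorphic_on_open[OF open_halfspace_Re_gt], intro ballI exI)
  fix z :: complex assume "z \<in> {z. Re z > 0}"
  thus "((\<lambda>z. z powr s) has_field_derivative s * z powr (s - 1)) (at z)"
    by (intro has_field_derivative_powr) (auto simp: complex_nonpos_Reals_iff)
qed

lemma has_field_derivative_powr_minus:
  assumes "Re z > 0"
  shows "((\<lambda>z. z powr - of_real a) has_field_derivative - of_real a * z powr - of_real (a + 1)) (at z)"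
proof -
  have "- of_real a - 1 = - complex_of_real (a + 1)"
    by simp
  thus ?thesis
    using has_field_derivative_powr[of z "- of_real a"] assms
    by (metis complex_nonpos_Reals_iff not_le)
qed

lemma norm_powr_minus_le:
  assumes "a \<ge> 0" "0 < r" "r \<le> norm z"
  shows "norm (z powr - complex_of_real a) \<le> r powr - a"
  using assms by (simp add: norm_powr_minus powr_mono2')

text \<open>
  On \<open>z = 1 + \<i> y\<close> the Poisson kernel \<open>2 / (1 + y\<^sup>2)\<close> is \<open>2 / (z (2 - z))\<close>. Subtracting the value at the
  pole \<open>z = 2\<close> removes the singularity and makes the integral over \<open>Re z = R\<close> tend to 0 as \<open>R\<close> grows.
\<close>

lemma Poisson_powr:
  assumes b: "b > 0"
  shows "(CLBINT y. Complex 1 y powr - of_real b / (1 + y\<^sup>2)) = of_real (pi * 2 powr - b)"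
proof -
  define g where "g = (\<lambda>z::complex. z powr - of_real b)"
  \<comment> \<open>The value \<open>deriv g 2\<close> fills the removable singularity, so
    \<open>q\<close> is holomorphic on the half-plane. On \<open>Re z = 1\<close> we have
    \<open>(z - 2) * z = - (1 + y^2)\<close>, so \<open>q\<close> is there the Poisson kernel
    \<open>2 / (1 + y^2)\<close> times \<open>g z - g 2\<close>.\<close>
  define q where "q = (\<lambda>z. (if z = 2 then deriv g 2 else (g z - g 2) / (z - 2)) * (- 2 / z))"
  have pos: "1 + y\<^sup>2 > 0" for y :: real
    by (intro add_pos_nonneg) auto
  have op: "open {z. Re z > 0}"
    by (rule open_halfspace_Re_gt)
  have holg: "g holomorphic_on {z. Re z > 0}"
    unfolding g_def by (rule holomorphic_powr_right_half_plane)
  have holq: "q holomorphic_on {z. Re z > 0}"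
    unfolding q_def by (intro holomorphic_intros pole_lemma_open holg op) auto
  have g_le: "norm (g z) \<le> 1" if "Re z \<ge> 1" for z
    using norm_powr_minus_le[of b 1 z] b that complex_Re_le_cmod[of z] by (simp add: g_def)
  define g' where "g' = (\<lambda>z::complex. - of_real b * z powr - of_real (b + 1))"
  have g': "(g has_field_derivative g' z) (at z)" if "Re z > 0" for z
    unfolding g_def g'_def using that by (rule has_field_derivative_powr_minus)
  have g'_le: "norm (g' z) \<le> b" if "Re z \<ge> 1" for z
    using norm_powr_minus_le[of "b + 1" 1 z] b that complex_Re_le_cmod[of z]
    by (simp add: g'_def norm_mult mult_left_le del: of_real_add)
  \<comment> \<open>The mean value inequality bounds the difference quotient by the supremum of the
    derivative, a bound that does not degenerate near \<open>z = 2\<close>.\<close>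
  have dq_le: "norm (if z = 2 then deriv g 2 else (g z - g 2) / (z - 2)) \<le> b" if z: "Re z \<ge> 1" for z
  proof (cases "z = 2")
    case True
    thus ?thesis using DERIV_imp_deriv[OF g'[of 2]] g'_le[of 2] by simp
  next
    case False
    have "norm (g z - g 2) \<le> b * norm (z - 2)"
    proof (rule field_differentiable_bound[of "{z. Re z \<ge> 1}"])
      show "(g has_field_derivative g' w) (at w within {z. Re z \<ge> 1})" if "w \<in> {z. Re z \<ge> 1}" for w
        using that by (intro has_field_derivative_at_within[OF g']) auto
    qed (use z g'_le in \<open>auto simp: convex_halfspace_Re_ge\<close>)
    thus ?thesis using False by (simp add: norm_divide field_simps)
  qed
  have q_le1: "norm (q z) \<le> 2 * b" if z: "Re z \<ge> 1" for z
  proof -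
    have "norm z \<ge> 1" using z complex_Re_le_cmod[of z] by linarith
    hence "norm (- 2 / z) \<le> 2"
      using frac_le[of 2 2 1 "norm z"] by (simp add: norm_divide)
    hence "norm (q z) \<le> b * 2"
      unfolding q_def norm_mult using b by (intro mult_mono dq_le z) auto
    thus ?thesis by simp
  qed
  have q_le2: "norm (q z) \<le> 4 / (norm (z - 2) * norm z)" if z: "Re z \<ge> 1" "z \<noteq> 2" for z
  proof -
    have "norm (g z - g 2) \<le> 2"
      using norm_triangle_ineq4[of "g z" "g 2"] g_le[of z] g_le[of 2] z by simp
    hence "norm (g z - g 2) * 2 / (norm (z - 2) * norm z) \<le> 2 * 2 / (norm (z - 2) * norm z)"
      by (intro divide_right_mono mult_right_mono) auto
    thus ?thesis using z by (simp add: q_def norm_mult norm_divide del: right_diff_distrib_numeral left_diff_distrib_numeral)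
  qed
  have shift: "(CLBINT y. q (Complex 1 y)) = (CLBINT y. q (Complex R y))" if "R \<ge> 1" for R
  proof (rule integral_vertical_line_shift[OF holq])
    fix x y :: real assume x: "1 \<le> x" "x \<le> R"
    \<comment> \<open>The constant adds up two cases. For small \<open>y\<close>,
      \<open>q_le1\<close> and \<open>1 + y^2 \<le> 2\<close> give \<open>4 * b\<close>; for large
      \<open>y\<close>, \<open>q_le2\<close> and \<open>1 + y^2 \<le> 2 * y^2\<close> give
      8.\<close>
    show "norm (q (Complex x y)) \<le> (4 * b + 8) / (1 + y\<^sup>2)"
    proof (cases "\<bar>y\<bar> \<le> 1")
      case True
      hence "2 * b * (1 + y\<^sup>2) \<le> 2 * b * 2"
        using b abs_square_le_1[of y] by (intro mult_left_mono) auto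
      hence "2 * b \<le> (4 * b + 8) / (1 + y\<^sup>2)"
        using b by (subst pos_le_divide_eq[OF pos]) linarith
      thus ?thesis using q_le1[of "Complex x y"] x by auto
    next
      case False
      hence y: "\<bar>y\<bar> > 1" by simp
      have "\<bar>y\<bar> \<le> norm (Complex x y - 2)"
        using abs_Im_le_cmod[of "Complex x y - 2"] by simp
      hence "\<bar>y\<bar> * \<bar>y\<bar> \<le> norm (Complex x y - 2) * norm (Complex x y)"
        using norm_Complex_ge(2)[of y x] by (intro mult_mono) auto
      hence "4 / (norm (Complex x y - 2) * norm (Complex x y)) \<le> 4 / y\<^sup>2"
        using y by (intro frac_le) (auto simp: power2_eq_square simp flip: power2_eq_square)
      moreover have "1 \<le> y\<^sup>2"
        using y abs_square_less_1[of y] by (simp add: not_less flip: not_less)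
      hence "4 * (1 + y\<^sup>2) \<le> 8 * y\<^sup>2" "0 \<le> 4 * b * y\<^sup>2"
        using b by auto
      hence "4 * (1 + y\<^sup>2) \<le> (4 * b + 8) * y\<^sup>2"
        unfolding distrib_right by linarith
      hence "4 / y\<^sup>2 \<le> (4 * b + 8) / (1 + y\<^sup>2)"
        using y by (subst pos_le_divide_eq[OF pos]) (auto simp: divide_le_eq)
      moreover have "Complex x y \<noteq> 2" using y by (auto simp: complex_eq_iff)
      ultimately show ?thesis
        using q_le2[of "Complex x y"] x by simp
    qed
  qed (use that in auto)
  have cont: "continuous_on UNIV (\<lambda>y. q (Complex x y))" if "x > 0" for x
    by (intro continuous_on_vertical_line holomorphic_on_imp_continuous_on holq that)
  \<comment> \<open>The lines \<open>Re z = 3 + n\<close> have distance \<open>1 + n\<close> from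
    the pole at 2. The bound tends to 0 pointwise as \<open>n\<close> grows, and its value at
    \<open>n = 0\<close> is a common integrable majorant.\<close>
  have far: "norm (q (Complex (3 + real n) y)) \<le> 4 / ((1 + real n)\<^sup>2 + y\<^sup>2)" for n y
  proof -
    let ?z = "Complex (3 + real n) y"
    have "(norm (?z - 2))\<^sup>2 = (1 + real n)\<^sup>2 + y\<^sup>2"
      by (simp add: cmod_power2)
    moreover have "norm (?z - 2) \<le> norm ?z"
      by (simp add: cmod_def)
    hence "norm (?z - 2) * norm (?z - 2) \<le> norm (?z - 2) * norm ?z"
      by (intro mult_left_mono) auto
    ultimately have le: "(1 + real n)\<^sup>2 + y\<^sup>2 \<le> norm (?z - 2) * norm ?z"
      by (simp add: power2_eq_square)
    have pos: "0 < (1 + real n)\<^sup>2 + y\<^sup>2"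
      by (intro add_pos_nonneg) auto
    have "norm (q ?z) \<le> 4 / (norm (?z - 2) * norm ?z)"
      by (rule q_le2) (auto simp: complex_eq_iff)
    also have "\<dots> \<le> 4 / ((1 + real n)\<^sup>2 + y\<^sup>2)"
      using le pos by (intro divide_left_mono mult_pos_pos) (auto simp: complex_eq_iff)
    finally show ?thesis .
  qed
  have "(\<lambda>n. CLBINT y. q (Complex (3 + real n) y)) \<longlonglongrightarrow> (CLBINT y::real. 0)"
  proof (rule integral_dominated_convergence)
    show "integrable lborel (\<lambda>y::real. 4 / (1 + y\<^sup>2))"
      by (rule integrable_inverse_one_plus_square)
    show "(\<lambda>y. q (Complex (3 + real n) y)) \<in> borel_measurable lborel" for n
      using borel_measurable_continuous_onI[OF cont[of "3 + real n"]] by simp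
    show "AE y in lborel. norm (q (Complex (3 + real n) y)) \<le> 4 / (1 + y\<^sup>2)" for n
    proof (intro always_eventually allI order_trans[OF far])
      fix y :: real
      show "4 / ((1 + real n)\<^sup>2 + y\<^sup>2) \<le> 4 / (1 + y\<^sup>2)"
        using one_le_power[of "1 + real n" 2]
        by (intro divide_left_mono mult_pos_pos add_pos_nonneg) auto
    qed
    show "AE y in lborel. (\<lambda>n. q (Complex (3 + real n) y)) \<longlonglongrightarrow> 0"
    proof (intro always_eventually allI)
      fix y
      have "(\<lambda>n. 4 / ((1 + real n)\<^sup>2 + y\<^sup>2)) \<longlonglongrightarrow> 0"
        by real_asymp
      thus "(\<lambda>n. q (Complex (3 + real n) y)) \<longlonglongrightarrow> 0"
        by (rule Lim_null_comparison[OF always_eventually[OF allI[OF far]]])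
    qed
  qed auto
  moreover have "(CLBINT y. q (Complex (3 + real n) y)) = (CLBINT y. q (Complex 1 y))" for n
    by (rule shift[symmetric]) simp
  ultimately have q0: "(CLBINT y. q (Complex 1 y)) = 0"
    by (simp add: LIMSEQ_const_iff)
  have q1: "q (Complex 1 y) = 2 * (g (Complex 1 y) / (1 + y\<^sup>2) - g 2 * of_real (1 / (1 + y\<^sup>2)))" for y
  proof -
    have *: "(Complex 1 y - 2) * Complex 1 y = - of_real (1 + y\<^sup>2)"
      by (simp add: complex_eq_iff power2_eq_square)
    have ne: "Complex 1 y \<noteq> 2"
      by (simp add: complex_eq_iff)
    hence "q (Complex 1 y) = - (2 * (g (Complex 1 y) - g 2)) / ((Complex 1 y - 2) * Complex 1 y)"
      by (simp add: q_def mult.commute del: right_diff_distrib_numeral left_diff_distrib_numeral)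
    also have "\<dots> = 2 * (g (Complex 1 y) - g 2) / of_real (1 + y\<^sup>2)"
      unfolding * by (simp del: of_real_add right_diff_distrib_numeral left_diff_distrib_numeral)
    finally show ?thesis
      by (simp add: diff_divide_distrib right_diff_distrib)
  qed
  have int1: "integrable lborel (\<lambda>y. g (Complex 1 y) / (1 + y\<^sup>2))"
  proof (rule integrable_if_dominated[OF _ integrable_inverse_one_plus_square[of 1]])
    have "complex_of_real (1 + y\<^sup>2) \<noteq> 0" for y
      using pos[of y] by (simp only: of_real_eq_0_iff)
    thus "continuous_on UNIV (\<lambda>y. g (Complex 1 y) / (1 + y\<^sup>2))"
      by (intro continuous_intros continuous_on_vertical_line holomorphic_on_imp_continuous_on holg) auto
    show "norm (g (Complex 1 y) / (1 + y\<^sup>2)) \<le> 1 / (1 + y\<^sup>2)" for y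
      using g_le[of "Complex 1 y"] pos[of y]
      by (simp add: norm_divide divide_right_mono abs_of_pos del: of_real_add)
  qed
  have int2: "integrable lborel (\<lambda>y. g 2 * complex_of_real (1 / (1 + y\<^sup>2)))"
    by (intro integrable_mult_right integrable_of_real integrable_inverse_one_plus_square)
  have "0 = (CLBINT y. 2 * (g (Complex 1 y) / (1 + y\<^sup>2) - g 2 * of_real (1 / (1 + y\<^sup>2))))"
    using q0 unfolding q1 ..
  also have "\<dots> = 2 * ((CLBINT y. g (Complex 1 y) / (1 + y\<^sup>2)) - (CLBINT y. g 2 * of_real (1 / (1 + y\<^sup>2))))"
    by (subst Bochner_Integration.integral_diff[OF int1 int2, symmetric]) (rule integral_mult_right_zero)
  also have "(CLBINT y. g 2 * of_real (1 / (1 + y\<^sup>2))) = g 2 * of_real pi"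
    using integral_inverse_one_plus_square[of 1] by (simp del: of_real_divide)
  finally show ?thesis
    using powr_of_real[of 2 "- b"] by (simp add: g_def mult.commute)
qed

section \<open>Bounds, rescaling and shifting for the integrals of
  \<open>exp (L * z) * z powr -a\<close> over vertical lines\<close>

lemma continuous_on_Complex [continuous_intros]:
  assumes "continuous_on A f" "continuous_on A g"
  shows "continuous_on A (\<lambda>x. Complex (f x) (g x))"
  unfolding Complex_eq by (intro continuous_intros assms)

text \<open>Two of the \<open>a\<close> powers of the modulus are spent on decay in
  \<open>y\<close>, through \<open>norm z ^ 2 \<ge> s^2 + y^2 \<ge> min 1 (s^2) * (1 + y^2)\<close>;
  the remaining \<open>a - 2\<close> are bounded by their value at \<open>s\<close>. The bound is
  uniform to the right of the line \<open>Re z = s\<close>, as shifting lines requires.\<close>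

lemma powr_line_bound:
  assumes "a \<ge> 2" "0 < s" "s \<le> x"
  shows "norm (Complex x y powr - of_real a) \<le> s powr - (a - 2) / min 1 (s\<^sup>2) / (1 + y\<^sup>2)"
proof -
  let ?n = "norm (Complex x y)"
  have n: "s \<le> ?n" using norm_Complex_ge(1)[of x y] assms by linarith
  have pos: "1 + y\<^sup>2 > 0" by (intro add_pos_nonneg) auto
  have "min 1 (s\<^sup>2) * (1 + y\<^sup>2) \<le> s\<^sup>2 + y\<^sup>2"
    using mult_right_mono[of "s\<^sup>2" 1 "y\<^sup>2"] by (cases "s\<^sup>2 \<le> 1") (simp_all add: algebra_simps)
  also have "\<dots> \<le> ?n\<^sup>2"
    using assms by (simp add: cmod_power2 power_mono)
  finally have le: "min 1 (s\<^sup>2) * (1 + y\<^sup>2) \<le> ?n\<^sup>2" .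
  have "norm (Complex x y powr - of_real a) = ?n powr - (a - 2) * ?n powr (- 2)"
    by (simp add: norm_powr_minus flip: powr_add)
  also have "?n powr (- 2) = 1 / ?n\<^sup>2"
    using n assms by (simp add: powr_minus_divide)
  also have "?n powr - (a - 2) * (1 / ?n\<^sup>2) \<le> s powr - (a - 2) * (1 / (min 1 (s\<^sup>2) * (1 + y\<^sup>2)))"
    using assms n pos le by (intro mult_mono powr_mono2' frac_le mult_pos_pos) auto
  finally show ?thesis by (simp add: field_simps)
qed

lemma integrable_exp_powr_line:
  assumes "a \<ge> 2" "s > 0"
  shows "integrable lborel (\<lambda>y. exp (of_real L * Complex s y) * Complex s y powr - of_real a)"
proof (rule integrable_if_dominated)
  show "integrable lborel (\<lambda>y::real. exp (L * s) * (s powr - (a - 2) / min 1 (s\<^sup>2)) / (1 + y\<^sup>2))"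
    by (rule integrable_inverse_one_plus_square)
  show "continuous_on UNIV (\<lambda>y. exp (of_real L * Complex s y) * Complex s y powr - of_real a)"
    using assms
    by (intro continuous_on_vertical_line[of "\<lambda>z. exp (of_real L * z) * z powr - of_real a"]
        holomorphic_on_imp_continuous_on holomorphic_intros holomorphic_powr_right_half_plane)
  show "norm (exp (of_real L * Complex s y) * Complex s y powr - of_real a)
      \<le> exp (L * s) * (s powr - (a - 2) / min 1 (s\<^sup>2)) / (1 + y\<^sup>2)" for y
    using mult_left_mono[OF powr_line_bound[of a s s y], of "exp (L * s)"] assms
    by (simp add: norm_mult)
qed

text \<open>On \<open>Re z = 1 / L\<close> the point \<open>L * z\<close> runs through the line
  \<open>Re = 1\<close>. The substitution contributes \<open>1 / L\<close> and the power contributes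
  \<open>L powr a\<close>.\<close>

lemma exp_powr_line_scale:
  assumes L: "L > 0"
  shows "(CLBINT y. exp (of_real L * Complex (1 / L) y) * Complex (1 / L) y powr - of_real a)
       = of_real (L powr (a - 1)) * (CLBINT y. exp (Complex 1 y) * Complex 1 y powr - of_real a)"
proof -
  have eq: "Complex (1 / L) (0 + 1 / L * y) = of_real (1 / L) * Complex 1 y" for y
    using L by (simp add: complex_eq_iff)
  have pw: "(of_real (1 / L) * Complex 1 y) powr - of_real a = of_real (L powr a) * Complex 1 y powr - of_real a" for y
  proof -
    have "(of_real (1 / L) * Complex 1 y) powr - of_real a =
        of_real (1 / L) powr of_real (- a) * Complex 1 y powr - of_real a"
      using L by (subst powr_times_real_left) auto
    also have "of_real (1 / L) powr of_real (- a) = complex_of_real (L powr a)"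
      using L by (subst powr_of_real) (auto simp: powr_divide powr_minus_divide)
    finally show ?thesis .
  qed
  have "(CLBINT y. exp (of_real L * Complex (1 / L) y) * Complex (1 / L) y powr - of_real a)
      = \<bar>1 / L\<bar> *\<^sub>R (CLBINT y. of_real (L powr a) * (exp (Complex 1 y) * Complex 1 y powr - of_real a))"
    by (subst lborel_integral_real_affine[of "1 / L" _ 0])
       (use L in \<open>simp_all only: eq pw, simp_all add: mult_ac\<close>)
  also have "\<dots> = of_real (L powr a / L) * (CLBINT y. exp (Complex 1 y) * Complex 1 y powr - of_real a)"
    using L by (simp add: scaleR_conv_of_real)
  also have "L powr a / L = L powr (a - 1)"
    using L by (simp add: powr_diff)
  finally show ?thesis .
qed

lemma exp_powr_line_shift:
  assumes a: "a \<ge> 2" and st: "0 < s" "s \<le> t" and L: "L \<ge> 0"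
  shows "(CLBINT y. exp (of_real L * Complex s y) * Complex s y powr - of_real a)
       = (CLBINT y. exp (of_real L * Complex t y) * Complex t y powr - of_real a)"
proof (rule integral_vertical_line_shift)
  show "(\<lambda>z. exp (of_real L * z) * z powr - of_real a) holomorphic_on {z. 0 < Re z}"
    by (intro holomorphic_intros holomorphic_powr_right_half_plane)
  fix x y :: real assume x: "s \<le> x" "x \<le> t"
  have "norm (exp (of_real L * Complex x y) * Complex x y powr - of_real a)
     \<le> exp (L * t) * (s powr - (a - 2) / min 1 (s\<^sup>2) / (1 + y\<^sup>2))"
    unfolding norm_mult using x L a st
    by (intro mult_mono powr_line_bound) (auto intro!: mult_left_mono)
  thus "norm (exp (of_real L * Complex x y) * Complex x y powr - of_real a)
     \<le> (exp (L * t) * (s powr - (a - 2) / min 1 (s\<^sup>2))) / (1 + y\<^sup>2)"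
    by simp
qed (use st in auto)

section \<open>Laplace transforms on the half-line and the value of the constant\<close>

lemma set_integrable_exp_minus:
  assumes "(a :: real) > 0"
  shows "set_integrable lborel {0<..} (\<lambda>x. exp (- a * x))"
proof (rule set_integrable_subset)
  show "set_integrable lborel {0..} (\<lambda>x. exp (- a * x))"
    unfolding set_integrable_def
    using nonnegative_absolutely_integrable_1[OF integrable_on_exp_minus_to_infinity[OF assms]]
    by (subst integrable_completion[symmetric]) (auto simp: set_integrable_def)
qed auto

lemma integral_exp_half_line:
  assumes w: "Re w > 0"
  shows "(CLBINT x:{0<..}. exp (- (w * of_real x))) = 1 / w"
proof -
  have w0: "w \<noteq> 0" using w by auto
  have n: "norm (exp (- (w * of_real x))) = exp (- Re w * x)" for x
    by simp
  have i0: "set_integrable lborel {0<..} (\<lambda>x. exp (- Re w * x))"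
    by (rule set_integrable_exp_minus[OF w])
  have int: "set_integrable lborel {0<..} (\<lambda>x. exp (- (w * of_real x)))"
    by (rule set_integrable_bound[OF i0]) (auto simp: set_borel_measurable_def intro!: borel_measurable_scaleR borel_measurable_indicator
         borel_measurable_continuous_onI continuous_intros)
  have "(CLBINT x=0..\<infinity>. exp (- (w * of_real x))) = 0 - (- 1 / w)"
  proof (rule interval_integral_FTC_integrable)
    show "((\<lambda>x. - exp (- (w * of_real x)) / w) has_vector_derivative exp (- (w * of_real x))) (at x)" for x
      using w0 by (auto intro!: derivative_eq_intros has_vector_derivative_real_field)
    show "isCont (\<lambda>x. exp (- (w * complex_of_real x))) x" for x
      by (intro continuous_intros)
    show "set_integrable lborel (einterval 0 \<infinity>) (\<lambda>x. exp (- (w * of_real x)))"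
      by (rule set_integrable_subset[OF int]) (auto simp: einterval_def)
    show "(((\<lambda>x. - exp (- (w * of_real x)) / w) \<circ> real_of_ereal) \<longlongrightarrow> - 1 / w) (at_right 0)"
      unfolding zero_ereal_def ereal_tendsto_simps
      by (intro tendsto_eq_intros) (use w0 in auto)
    have "((\<lambda>x. exp (- Re w * x)) \<longlongrightarrow> 0) at_top"
      using w by real_asymp
    hence "((\<lambda>x. exp (- (w * of_real x))) \<longlongrightarrow> 0) at_top"
      by (subst tendsto_norm_zero_iff[symmetric]) simp
    hence "((\<lambda>x. - exp (- (w * of_real x)) / w) \<longlongrightarrow> - 0 / w) at_top"
      using w0 by (intro tendsto_intros)
    thus "(((\<lambda>x. - exp (- (w * of_real x)) / w) \<circ> real_of_ereal) \<longlongrightarrow> 0) (at_left \<infinity>)"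
      unfolding ereal_tendsto_simps by simp
  qed simp
  also have "(CLBINT x=0..\<infinity>. exp (- (w * of_real x))) = (CLBINT x:{0<..}. exp (- (w * of_real x)))"
    by (simp add: interval_lebesgue_integral_def zero_ereal_def einterval_eq)
  finally show ?thesis by simp
qed

text \<open>Euler's integral after the substitution of \<open>2 * x\<close>; this is the Laplace
  transform of \<open>x powr (a - 1)\<close> at 2.\<close>

lemma integral_Gamma_half_line:
  fixes a :: real
  assumes "a > 0"
  shows "(LBINT x:{0<..}. x powr (a - 1) * exp (- (2 * x))) = Gamma a / 2 powr a"
proof -
  have "has_bochner_integral lborel (\<lambda>x. indicator {0..} x * (x powr (a - 1) / exp x)) (Gamma a)"
    using Gamma_conv_nn_integral_real[OF assms] assms
    by (intro has_bochner_integral_nn_integral) (auto simp: Gamma_real_pos less_imp_le)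
  hence "(LBINT x. indicator {0..} x * (x powr (a - 1) / exp x)) = Gamma a"
    by (rule has_bochner_integral_integral_eq)
  hence "Gamma a = 2 * (LBINT x. indicator {0..} (2 * x) * ((2 * x) powr (a - 1) / exp (2 * x)))"
    by (subst (asm) lborel_integral_real_affine[of 2 _ 0]) auto
  also have "(\<lambda>x::real. indicator {0..} (2 * x) * ((2 * x) powr (a - 1) / exp (2 * x))) =
     (\<lambda>x. 2 powr (a - 1) * (indicator {0<..} x *\<^sub>R (x powr (a - 1) * exp (- (2 * x)))))"
    by (auto simp: fun_eq_iff indicator_def powr_mult exp_minus field_simps)
  also have "2 * (LBINT x. 2 powr (a - 1) * (indicator {0<..} x *\<^sub>R (x powr (a - 1) * exp (- (2 * x))))) =
      2 powr a * (LBINT x:{0<..}. x powr (a - 1) * exp (- (2 * x)))"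
    using powr_add[of 2 "a - 1" 1] by (simp add: set_lebesgue_integral_def)
  finally show ?thesis by (simp add: field_simps)
qed

text \<open>
  Shifting and scaling turn the integral of \<open>exp (x z) z powr -a\<close> into \<open>x powr (a - 1) * K\<close>. Its Laplace
  transform in \<open>x\<close> at 2 is \<open>K \<Gamma>(a) / 2 powr a\<close>, and by Fubini also \<open>2 \<pi> / 2 powr a\<close>.
\<close>

lemma exp_powr_line_const:
  assumes a: "a \<ge> 2"
  shows "(CLBINT y. exp (Complex 1 y) * Complex 1 y powr - of_real a) = of_real (2 * pi / Gamma a)"
proof -
  define K where "K = (CLBINT y. exp (Complex 1 y) * Complex 1 y powr - of_real a)"
  define f where "f = (\<lambda>x y. exp (of_real x * Complex 1 y) * Complex 1 y powr - of_real a)"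
  define h where "h = (\<lambda>x y. indicator {0<..} x *\<^sub>R (of_real (exp (- (2 * x))) * f x y))"
  have z: "Complex 1 y \<noteq> 0" "Complex 1 y \<notin> \<real>\<^sub>\<le>\<^sub>0" for y
    by (auto simp: complex_eq_iff complex_nonpos_Reals_iff)
  have intf: "integrable lborel (f x)" for x
    unfolding f_def using a by (intro integrable_exp_powr_line) auto
  \<comment> \<open>The weight \<open>exp (- (2 * x))\<close> outweighs \<open>exp x\<close>, the
    modulus of \<open>exp (x * z)\<close> on \<open>Re z = 1\<close>. What remains is a product of a
    function of \<open>x\<close> and a function of \<open>y\<close>, both integrable, which
    justifies Fubini.\<close>
  have norm_h: "norm (h x y) = (indicator {0<..} x *\<^sub>R exp (- 1 * x)) * norm (f 0 y)" for x y
    by (auto simp: h_def f_def norm_mult indicator_def simp flip: exp_add)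
  have "integrable (lborel \<Otimes>\<^sub>M lborel) (\<lambda>(x, y). h x y)"
  proof (rule lborel_pair.Fubini_integrable)
    have "continuous_on UNIV (\<lambda>p. of_real (exp (- (2 * fst p))) * f (fst p) (snd p))"
      unfolding f_def using z by (intro continuous_intros) auto
    from borel_measurable_continuous_onI[OF this]
    have "(\<lambda>p. indicator {0<..} (fst p) *\<^sub>R (of_real (exp (- (2 * fst p))) * f (fst p) (snd p)))
        \<in> borel_measurable (lborel \<Otimes>\<^sub>M lborel)"
      unfolding borel_prod[symmetric] by measurable
    thus "(\<lambda>(x, y). h x y) \<in> borel_measurable (lborel \<Otimes>\<^sub>M lborel)"
      by (simp add: h_def case_prod_beta')
    have "set_integrable lborel {0<..} (\<lambda>x::real. exp (- 1 * x))"
      by (rule set_integrable_exp_minus) simp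
    thus "integrable lborel (\<lambda>x. LBINT y. norm (case (x, y) of (x, y) \<Rightarrow> h x y))"
      by (simp only: prod.case norm_h set_integrable_def integral_mult_right_zero integrable_mult_left)
    show "AE x in lborel. integrable lborel (\<lambda>y. case (x, y) of (x, y) \<Rightarrow> h x y)"
      using intf by (simp add: h_def)
  qed
  hence Fubini: "(CLBINT y. CLBINT x. h x y) = (CLBINT x. CLBINT y. h x y)"
    by (rule lborel_pair.Fubini_integral)
  \<comment> \<open>With \<open>z = Complex 1 y\<close>, integrating over \<open>x\<close> first
    gives \<open>1 / (2 - z)\<close>, which equals \<open>z / (1 + y^2)\<close>. This lowers the
    exponent by one and leaves the Poisson integral.\<close>
  have inner1: "(CLBINT x. h x y) = Complex 1 y powr - of_real (a - 1) / of_real (1 + y\<^sup>2)" for y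
  proof -
    have "(CLBINT x. h x y) = (CLBINT x. Complex 1 y powr - of_real a * (indicator {0<..} x *\<^sub>R exp (- (Complex 1 (- y) * of_real x))))"
    proof (rule Bochner_Integration.integral_cong[OF refl])
      fix x
      have "of_real (exp (- (2 * x))) * exp (of_real x * Complex 1 y) = exp (- (Complex 1 (- y) * of_real x))"
        by (simp only: exp_of_real[symmetric] exp_add[symmetric])
           (rule arg_cong[where f = exp], simp add: complex_eq_iff)
      thus "h x y = Complex 1 y powr - of_real a * (indicator {0<..} x *\<^sub>R exp (- (Complex 1 (- y) * of_real x)))"
        by (simp add: h_def f_def mult_ac)
    qed
    also have "\<dots> = Complex 1 y powr - of_real a * (1 / Complex 1 (- y))"
      using integral_exp_half_line[of "Complex 1 (- y)"]
      by (simp only: integral_mult_right_zero set_lebesgue_integral_def) simp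
    also have "1 / Complex 1 (- y) = Complex 1 y / of_real (1 + y\<^sup>2)"
    proof -
      have "Complex 1 y * Complex 1 (- y) = of_real (1 + y\<^sup>2)"
        by (simp add: complex_eq_iff power2_eq_square)
      from this[symmetric] show ?thesis
        using z[of y] by simp
    qed
    also have "Complex 1 y powr - of_real a * (Complex 1 y / of_real (1 + y\<^sup>2))
        = Complex 1 y powr (- of_real a + 1) / of_real (1 + y\<^sup>2)"
      using z[of y] by (simp only: powr_add) simp
    finally show ?thesis by simp
  qed
  have outer1: "(CLBINT y. Complex 1 y powr - of_real (a - 1) / of_real (1 + y\<^sup>2)) = of_real (pi * 2 powr - (a - 1))"
    using a by (intro Poisson_powr) auto
  \<comment> \<open>For fixed \<open>x > 0\<close> the line is moved from \<open>Re z = 1\<close> to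
    \<open>Re z = 1 / x\<close> and then rescaled. The shift goes right or left according to whether
    \<open>1 / x \<ge> 1\<close>.\<close>
  have inner2: "(CLBINT y. h x y) = K * of_real (indicator {0<..} x *\<^sub>R (x powr (a - 1) * exp (- (2 * x))))" for x
  proof (cases "x > 0")
    case True
    have "(CLBINT y. f x y) = (CLBINT y. exp (of_real x * Complex (1 / x) y) * Complex (1 / x) y powr - of_real a)"
      unfolding f_def using True a exp_powr_line_shift[of a 1 "1 / x" x] exp_powr_line_shift[of a "1 / x" 1 x]
      by (cases "1 / x \<ge> 1") auto
    also have "\<dots> = of_real (x powr (a - 1)) * K"
      unfolding K_def by (rule exp_powr_line_scale[OF True])
    finally show ?thesis using True by (simp add: h_def mult_ac)
  qed (simp add: h_def)
  have outer2: "(CLBINT x. K * of_real (indicator {0<..} x *\<^sub>R (x powr (a - 1) * exp (- (2 * x))))) =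
      K * of_real (Gamma a / 2 powr a)"
    using integral_Gamma_half_line[of a] a
    by (simp only: integral_mult_right_zero integral_complex_of_real set_lebesgue_integral_def)
  have "K * of_real (Gamma a / 2 powr a) = of_real (pi * 2 powr - (a - 1))"
    using Fubini unfolding inner1 inner2 outer1 outer2 by (rule sym)
  moreover have "Gamma a > 0" using a by simp
  ultimately have "K = of_real (pi * 2 powr - (a - 1) / (Gamma a / 2 powr a))"
    by (simp add: field_simps)
  also have "pi * 2 powr - (a - 1) / (Gamma a / 2 powr a) = 2 * pi / Gamma a"
    using \<open>Gamma a > 0\<close> by (simp add: powr_diff powr_minus field_simps)
  finally show ?thesis by (simp add: K_def)
qed

lemma exp_powr_line:
  assumes "a \<ge> 2" "L > 0"
  shows "(CLBINT y. exp (of_real L * Complex (1 / L) y) * Complex (1 / L) y powr - of_real a)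
       = of_real (2 * pi * L powr (a - 1) / Gamma a)"
  using exp_powr_line_scale[OF assms(2), of a] exp_powr_line_const[OF assms(1)] by simp

section \<open>Powers of the Gamma function in a strip\<close>

text \<open>The absolute value may be taken inside Euler's integral.\<close>

lemma norm_Gamma_le:
  assumes "Re z > 0"
  shows "norm (Gamma z) \<le> Gamma (Re z)"
proof -
  have cplx: "((\<lambda>t. of_real t powr (z - 1) / of_real (exp t)) has_integral Gamma z) {0<..}"
    using Gamma_integral_complex'[OF assms] .
  have "((\<lambda>t. of_real t powr (of_real (Re z) - 1) / complex_of_real (exp t)) has_integral Gamma (of_real (Re z))) {0<..}"
    using Gamma_integral_complex'[of "of_real (Re z)"] assms by simp
  from has_integral_linear[OF this bounded_linear_Re]
  have "((\<lambda>t. Re (of_real t powr (of_real (Re z) - 1) / complex_of_real (exp t))) has_integral Gamma (Re z)) {0<..}"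
    using assms by (simp add: o_def Gamma_complex_of_real)
  hence re: "((\<lambda>t. t powr (Re z - 1) / exp t) has_integral Gamma (Re z)) {0<..}"
  proof (rule has_integral_eq[rotated])
    fix t :: real assume "t \<in> {0<..}"
    thus "Re (of_real t powr (of_real (Re z) - 1) / complex_of_real (exp t)) = t powr (Re z - 1) / exp t"
      using powr_of_real[of t "Re z - 1"] by (simp del: of_real_exp flip: of_real_divide)
  qed
  have "norm (integral {0<..} (\<lambda>t. of_real t powr (z - 1) / complex_of_real (exp t)))
      \<le> integral {0<..} (\<lambda>t. t powr (Re z - 1) / exp t)"
  proof (rule integral_norm_bound_integral)
    show "norm (of_real t powr (z - 1) / complex_of_real (exp t)) \<le> t powr (Re z - 1) / exp t"
      if "t \<in> {0<..}" for t
      using that by (simp add: norm_divide norm_powr_real_powr)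
  qed (use cplx re in \<open>auto intro: has_integral_integrable\<close>)
  thus ?thesis
    using integral_unique[OF cplx] integral_unique[OF re] by simp
qed

text \<open>The functional equation trades each factor \<open>norm z\<close> for a shift of the
  argument by 1, and \<open>norm z \<le> norm (z + 1)\<close> lets the induction go on. This yields
  polynomial decay of every order on vertical lines without Stirling's formula.\<close>

lemma norm_Gamma_decay:
  assumes "Re z > 0"
  shows "norm (Gamma z) * norm z ^ n \<le> Gamma (Re z + real n)"
  using assms
proof (induction n arbitrary: z)
  case 0
  thus ?case by (simp add: norm_Gamma_le)
next
  case (Suc n)
  have "z \<notin> \<int>\<^sub>\<le>\<^sub>0"
    using Suc.prems by (auto elim!: nonpos_Ints_cases)
  hence "norm (Gamma z) * norm z ^ Suc n = norm (Gamma (z + 1)) * norm z ^ n"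
    by (simp add: Gamma_plus1 norm_mult)
  also have "norm z \<le> norm (z + 1)"
    using Suc.prems by (simp add: cmod_def power2_eq_square algebra_simps)
  hence "norm (Gamma (z + 1)) * norm z ^ n \<le> norm (Gamma (z + 1)) * norm (z + 1) ^ n"
    by (intro mult_left_mono power_mono) auto
  also have "\<dots> \<le> Gamma (Re (z + 1) + real n)"
    using Suc.prems by (intro Suc.IH) simp
  finally show ?case by (simp add: algebra_simps)
qed

lemma norm_Gamma_powr: "z \<notin> \<real>\<^sub>\<le>\<^sub>0 \<Longrightarrow> norm (Gamma_powr z c) = norm (Gamma z) powr c"
  by (simp add: Gamma_powr_def powr_def flip: ln_Gamma_branch(2))

text \<open>If \<open>n * c \<ge> 2\<close>, the \<open>c\<close>-th power of the decay of order
  \<open>n\<close> absorbs the square of the modulus. The strip is the one swept out by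
  \<open>1 + w\<close> when \<open>w\<close> lies within 1/2 of the strip
  \<open>0 \<le> Re z \<le> 1\<close>.\<close>

lemma Gamma_powr_decay:
  assumes c: "c > 0"
  shows "\<exists>B\<ge>0. \<forall>w. 1/2 \<le> Re w \<and> Re w \<le> 5/2 \<longrightarrow> norm (Gamma_powr w c) * (norm w)\<^sup>2 \<le> B"
proof -
  obtain n where n: "2 / c \<le> real n"
    using real_arch_simple by blast
  have "continuous_on {1/2..5/2} (\<lambda>x. Gamma (x + real n))"
    by (intro continuous_at_imp_continuous_on ballI isCont_Gamma continuous_intros)
       (auto dest: nonpos_Ints_nonpos)
  hence "bounded ((\<lambda>x. Gamma (x + real n)) ` {1/2..5/2})"
    by (intro compact_imp_bounded compact_continuous_image) auto
  then obtain M where "\<forall>y\<in>(\<lambda>x. Gamma (x + real n)) ` {1/2..5/2}. norm y \<le> M"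
    unfolding bounded_iff by blast
  hence M: "norm (Gamma (x + real n)) \<le> M" if "x \<in> {1/2..5/2}" for x
    using that by blast
  have M': "norm (Gamma w) * norm w ^ n \<le> M" if "1/2 \<le> Re w" "Re w \<le> 5/2" for w
    using norm_Gamma_decay[of w n] M[of "Re w"] that by force
  have nc: "2 \<le> real n * c"
    using n c by (simp add: field_simps)
  have "norm (Gamma_powr w c) * (norm w)\<^sup>2 \<le> 2 powr (real n * c) * M powr c"
    if w: "1/2 \<le> Re w" "Re w \<le> 5/2" for w
  proof -
    \<comment> \<open>Doubling the modulus makes the base at least 1, so that the exponent 2 may be
      raised to \<open>n * c\<close>; this is the source of the factor
      \<open>2 powr (n * c)\<close>.\<close>
    have nw: "1 \<le> 2 * norm w"
      using w complex_Re_le_cmod[of w] by linarith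
    have "w \<notin> \<real>\<^sub>\<le>\<^sub>0"
      using w by (auto simp: complex_nonpos_Reals_iff)
    hence "norm (Gamma_powr w c) * (norm w)\<^sup>2 = norm (Gamma w) powr c * (norm w)\<^sup>2"
      by (simp add: norm_Gamma_powr)
    also have "\<dots> \<le> norm (Gamma w) powr c * (2 powr (real n * c) * (norm w ^ n) powr c)"
    proof (rule mult_left_mono)
      have "(norm w)\<^sup>2 \<le> (2 * norm w) powr 2"
        using nw by (subst powr_numeral) (auto intro!: power_mono)
      also have "\<dots> \<le> (2 * norm w) powr (real n * c)"
        using nw nc by (intro powr_mono) auto
      also have "\<dots> = 2 powr (real n * c) * (norm w powr real n) powr c"
        by (simp add: powr_mult powr_powr)
      also have "norm w powr real n = norm w ^ n"
        using nw by (intro powr_realpow) linarith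
      finally show "(norm w)\<^sup>2 \<le> 2 powr (real n * c) * (norm w ^ n) powr c" .
    qed auto
    also have "\<dots> = 2 powr (real n * c) * (norm (Gamma w) * norm w ^ n) powr c"
      by (simp add: powr_mult)
    also have "\<dots> \<le> 2 powr (real n * c) * M powr c"
      using c by (intro mult_left_mono powr_mono2 M' w) auto
    finally show ?thesis .
  qed
  thus ?thesis by (intro exI[of _ "2 powr (real n * c) * M powr c"]) auto
qed

section \<open>Splitting off the singularity at 0, and bounds on the holomorphic factor\<close>

lemma holomorphic_ln_Gamma_Suc:
  assumes "\<And>z. z \<in> A \<Longrightarrow> 1 + z \<notin> \<real>\<^sub>\<le>\<^sub>0"
  shows "(\<lambda>z. ln_Gamma (1 + z :: complex)) holomorphic_on A"
proof -
  have "(ln_Gamma \<circ> (\<lambda>z. 1 + z)) holomorphic_on A"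
    using assms by (intro holomorphic_on_compose_gen[OF _ ln_Gamma_branch(1)] holomorphic_intros) auto
  thus ?thesis by (simp add: o_def)
qed

text \<open>The function \<open>ln_Gamma (1 + z) - Ln z\<close> is a holomorphic logarithm of
  \<open>Gamma\<close> on the slit plane and vanishes at 1, so it is \<open>ln_Gamma\<close> by
  uniqueness of the branch. An identity between values of \<open>Gamma\<close> alone would leave the
  branch of the power undetermined.\<close>

lemma Gamma_powr_eq:
  assumes "Re z > 0"
  shows "Gamma_powr z c = z powr - of_real c * Gamma_powr (1 + z) c"
proof -
  have nz: "1 + w \<notin> \<real>\<^sub>\<le>\<^sub>0" if "w \<notin> \<real>\<^sub>\<le>\<^sub>0" for w :: complex
    using that by (auto simp: complex_nonpos_Reals_iff)
  have "ln_Gamma (1 + z) - Ln z = ln_Gamma z"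
  proof (rule ln_Gamma_branch_unique)
    show "(\<lambda>z. ln_Gamma (1 + z) - Ln z) holomorphic_on - \<real>\<^sub>\<le>\<^sub>0"
      by (intro holomorphic_on_diff holomorphic_ln_Gamma_Suc holomorphic_on_Ln nz) auto
    show "exp (ln_Gamma (1 + w) - Ln w) = Gamma w" if w: "w \<notin> \<real>\<^sub>\<le>\<^sub>0" for w
    proof -
      have "w \<noteq> 0" "w \<notin> \<int>\<^sub>\<le>\<^sub>0"
        using w nonpos_Ints_subset_nonpos_Reals by auto
      thus ?thesis
        using Gamma_plus1[of w] by (simp add: exp_diff ln_Gamma_branch(2)[OF nz[OF w]] add.commute)
    qed
    have "Gamma (2 :: real) = 1"
      using Gamma_plus1[of "1 :: real"] by simp
    hence "ln_Gamma (2 :: real) = 0"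
      using Gamma_real_pos_exp[of 2] by simp
    thus "ln_Gamma (1 + 1) - Ln 1 = (0 :: complex)"
      using ln_Gamma_complex_of_real[of 2] by simp
    show "z \<notin> \<real>\<^sub>\<le>\<^sub>0"
      using assms by (simp add: complex_nonpos_Reals_iff)
  qed
  moreover have "z \<noteq> 0" using assms by auto
  ultimately show ?thesis
    by (simp add: Gamma_powr_def powr_def algebra_simps flip: exp_add)
qed

lemma holomorphic_Gamma_powr_Suc: "(\<lambda>z. Gamma_powr (1 + z) c) holomorphic_on {z. Re z > -1}"
  unfolding Gamma_powr_def
  by (intro holomorphic_on_exp' holomorphic_on_mult holomorphic_on_const holomorphic_ln_Gamma_Suc)
     (auto simp: complex_nonpos_Reals_iff)

text \<open>Cauchy's inequality on discs of radius 1/2. They stay to the right of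
  \<open>Re z = -1\<close>, where the function is holomorphic, and the decay estimate holds on their
  boundaries.\<close>

lemma Gamma_powr_Suc_deriv_bounds:
  assumes c: "c > 0"
  shows "\<exists>C\<ge>0. \<forall>k\<le>2. \<forall>z. 0 \<le> Re z \<and> Re z \<le> 1 \<longrightarrow>
           norm ((deriv ^^ k) (\<lambda>z. Gamma_powr (1 + z) c) z) \<le> C / (1 + (Im z)\<^sup>2)"
proof -
  define G where "G = (\<lambda>z. Gamma_powr (1 + z) c)"
  obtain B where B: "B \<ge> 0" "\<And>w. 1/2 \<le> Re w \<Longrightarrow> Re w \<le> 5/2 \<Longrightarrow> norm (Gamma_powr w c) * (norm w)\<^sup>2 \<le> B"
    using Gamma_powr_decay[OF c] by blast
  have "norm ((deriv ^^ k) G z) \<le> 32 * B / (1 + (Im z)\<^sup>2)"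
    if k: "k \<le> 2" and z: "0 \<le> Re z" "Re z \<le> 1" for k z
  proof -
    have strip: "- 1/2 \<le> Re w \<and> Re w \<le> 3/2" if "norm (z - w) \<le> 1/2" for w
      using abs_Re_le_cmod[of "z - w"] that z by auto
    have bound: "norm (G w) \<le> 4 * B / (1 + (Im z)\<^sup>2)" if w: "norm (z - w) = 1/2" for w
    proof -
      have "norm (1 + z) \<le> norm (1 + w) + norm (z - w)"
        using norm_triangle_ineq[of "1 + w" "z - w"] by (simp add: algebra_simps)
      moreover have "1 \<le> norm (1 + z)"
        using complex_Re_le_cmod[of "1 + z"] z by simp
      \<comment> \<open>Since \<open>1 \<le> norm (1 + z)\<close>, the radius 1/2 is at most half of
        \<open>norm (1 + z)\<close>. Thus the decay on the circle is comparable with the decay at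
        its centre.\<close>
      ultimately have "norm (1 + z) \<le> 2 * norm (1 + w)" "norm (1 + w) > 0"
        using w by linarith+
      hence "(norm (1 + z))\<^sup>2 \<le> (2 * norm (1 + w))\<^sup>2"
        by (intro power_mono) auto
      moreover have "(norm (1 + z))\<^sup>2 = (1 + Re z)\<^sup>2 + (Im z)\<^sup>2"
        by (simp add: cmod_power2)
      moreover have "1 \<le> (1 + Re z)\<^sup>2"
        using z by (intro one_le_power) auto
      ultimately have le: "1 + (Im z)\<^sup>2 \<le> 4 * (norm (1 + w))\<^sup>2"
        by (simp add: power_mult_distrib norm_power)
      have "norm (G w) * (1 + (Im z)\<^sup>2) \<le> norm (G w) * (4 * (norm (1 + w))\<^sup>2)"
        by (intro mult_left_mono le) auto
      also have "\<dots> \<le> 4 * B"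
        using B(2)[of "1 + w"] strip[of w] w by (simp add: G_def)
      finally show ?thesis
        by (subst pos_le_divide_eq) (auto intro: add_pos_nonneg)
    qed
    have "cball z (1/2) \<subseteq> {z. Re z > -1}"
      using strip by (force simp: dist_norm)
    hence hol: "G holomorphic_on cball z (1/2)"
      unfolding G_def using holomorphic_Gamma_powr_Suc holomorphic_on_subset by blast
    have "norm ((deriv ^^ k) G z) \<le> fact k * (4 * B / (1 + (Im z)\<^sup>2)) / (1/2) ^ k"
      using hol bound
      by (intro Cauchy_inequality holomorphic_on_imp_continuous_on)
         (auto intro: holomorphic_on_subset)
    also have "\<dots> = (4 * fact k * 2 ^ k) * (B / (1 + (Im z)\<^sup>2))"
      by (simp add: power_one_over)
    \<comment> \<open>The worst case is \<open>k = 2\<close>, with value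
      \<open>4 * 2 * 4\<close>.\<close>
    also have "4 * fact k * 2 ^ k \<le> (32 :: real)"
      using k by (auto simp: le_Suc_eq numeral_2_eq_2)
    hence "(4 * fact k * 2 ^ k) * (B / (1 + (Im z)\<^sup>2)) \<le> 32 * (B / (1 + (Im z)\<^sup>2))"
      using B(1) by (intro mult_right_mono divide_nonneg_nonneg) auto
    finally show ?thesis by simp
  qed
  thus ?thesis
    using B(1) by (intro exI[of _ "32 * B"]) (auto simp: G_def)
qed

text \<open>The mean value inequality on the convex closed strip, starting from 0, where the
  function equals 1 because \<open>ln_Gamma\<close> vanishes at 1.\<close>

lemma Gamma_powr_Suc_diff_bound:
  assumes C: "\<And>z. 0 \<le> Re z \<Longrightarrow> Re z \<le> 1 \<Longrightarrow> norm (deriv (\<lambda>z. Gamma_powr (1 + z) c) z) \<le> C"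
    and z: "0 \<le> Re z" "Re z \<le> 1"
  shows "norm (Gamma_powr (1 + z) c - 1) \<le> C * norm z"
proof -
  define S where "S = {z. 0 \<le> Re z} \<inter> {z. Re z \<le> 1}"
  have "norm (Gamma_powr (1 + z) c - Gamma_powr (1 + 0) c) \<le> C * norm (z - 0)"
  proof (rule field_differentiable_bound[of S])
    show "((\<lambda>z. Gamma_powr (1 + z) c) has_field_derivative deriv (\<lambda>z. Gamma_powr (1 + z) c) w) (at w within S)"
      if "w \<in> S" for w
      using that
      by (intro has_field_derivative_at_within[OF holomorphic_derivI[OF holomorphic_Gamma_powr_Suc]])
         (auto simp: S_def open_halfspace_Re_gt)
    show "convex S"
      unfolding S_def by (intro convex_Int convex_halfspace_Re_ge convex_halfspace_Re_le)
  qed (use C z in \<open>auto simp: S_def\<close>)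
  thus ?thesis by (simp add: Gamma_powr_def ln_Gamma_branch(3))
qed

section \<open>The asymptotic expansion\<close>

text \<open>With \<open>L = ln (1 / t)\<close> the factor \<open>t powr (\<i> * x - 1)\<close> is
  \<open>exp (L * (1 - \<i> * x))\<close>; the reflection \<open>x = - y\<close> then gives the line
  \<open>Re z = 1\<close> in its usual orientation.\<close>

lemma e_fun_eq_line_integral:
  assumes t: "t > 0"
  shows "of_real (e_fun c t) = 1 / (2 * of_real pi) *
     (CLBINT y. exp (of_real (ln (1 / t)) * Complex 1 y) * Gamma_powr (Complex 1 y) c)"
proof -
  define g where "g = (\<lambda>y. exp (of_real (ln (1 / t)) * Complex 1 y) * Gamma_powr (Complex 1 y) c)"
  have "e_integrand c t y = g (0 + - 1 * y)" for y
  proof -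
    have "Complex 1 (0 + - 1 * y) = 1 - \<i> * of_real y"
      by (simp add: complex_eq_iff)
    moreover have "of_real (ln (1 / t)) * (1 - \<i> * of_real y) = (\<i> * of_real y - 1) * complex_of_real (ln t)"
      using t by (simp add: ln_div algebra_simps)
    ultimately show ?thesis
      using t by (simp only: e_integrand_def g_def powr_def) (simp add: Ln_of_real)
  qed
  hence "(CLBINT y. e_integrand c t y) = (CLBINT y. g y)"
    using lborel_integral_real_affine[of "-1" g 0] by simp
  thus ?thesis
    unfolding of_real_e_fun[OF t] g_def by simp
qed

text \<open>Both integrations by parts are done at once:
  \<open>exp (L * z) * (L * F z - F1 z)\<close> has derivative
  \<open>exp (L * z) * (L^2 * F z - F2 z)\<close> and vanishes at both ends of the line.\<close>

lemma integral_exp_line_by_parts: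
  fixes F F1 F2 :: "complex \<Rightarrow> complex"
  assumes s: "s > 0"
    and F: "\<And>z. Re z > 0 \<Longrightarrow> (F has_field_derivative F1 z) (at z)"
    and F1: "\<And>z. Re z > 0 \<Longrightarrow> (F1 has_field_derivative F2 z) (at z)"
    and F2: "continuous_on {z. Re z > 0} F2"
    and B: "\<And>y. norm (F (Complex s y)) \<le> B / (1 + y\<^sup>2)" "\<And>y. norm (F1 (Complex s y)) \<le> B / (1 + y\<^sup>2)"
           "\<And>y. norm (F2 (Complex s y)) \<le> B / (1 + y\<^sup>2)"
  shows "of_real (L\<^sup>2) * (CLBINT y. exp (of_real L * Complex s y) * F (Complex s y)) =
         (CLBINT y. exp (of_real L * Complex s y) * F2 (Complex s y))"
proof -
  have contF: "continuous_on {z. Re z > 0} F"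
    using F by (intro continuous_at_imp_continuous_on) (auto intro: DERIV_isCont)
  have int: "integrable lborel (\<lambda>y. exp (of_real L * Complex s y) * H (Complex s y))"
    if "continuous_on {z. Re z > 0} H" "\<And>y. norm (H (Complex s y)) \<le> B / (1 + y\<^sup>2)" for H
  proof (rule integrable_if_dominated)
    show "integrable lborel (\<lambda>y::real. (exp (L * s) * B) / (1 + y\<^sup>2))"
      by (rule integrable_inverse_one_plus_square)
    show "continuous_on UNIV (\<lambda>y. exp (of_real L * Complex s y) * H (Complex s y))"
      using s that(1) by (intro continuous_on_vertical_line[of "\<lambda>z. exp (of_real L * z) * H z"] continuous_intros)
    show "norm (exp (of_real L * Complex s y) * H (Complex s y)) \<le> (exp (L * s) * B) / (1 + y\<^sup>2)" for y
      using mult_left_mono[OF that(2)[of y], of "exp (L * s)"] by (simp add: norm_mult)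
  qed
  have int2: "integrable lborel (\<lambda>y. exp (of_real L * Complex s y) * F2 (Complex s y))"
    by (intro int F2 B)
  have int0: "integrable lborel (\<lambda>y. exp (of_real L * Complex s y) * F (Complex s y))"
    by (intro int contF B)
  define f where "f = (\<lambda>z. exp (of_real L * z) * (of_real L * F z - F1 z))"
  define f' where "f' = (\<lambda>z. of_real (L\<^sup>2) * (exp (of_real L * z) * F z) - exp (of_real L * z) * F2 z)"
  have f: "(f has_field_derivative f' z) (at z)" if "Re z > 0" for z
    unfolding f_def f'_def
    by (rule derivative_eq_intros F[OF that] F1[OF that] refl)+ (simp add: algebra_simps power2_eq_square)
  have f_bd: "norm (f (Complex s y)) \<le> (exp (L * s) * ((\<bar>L\<bar> + 1) * B)) / (1 + y\<^sup>2)" for y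
  proof -
    have "norm (of_real L * F (Complex s y) - F1 (Complex s y)) \<le> \<bar>L\<bar> * (B / (1 + y\<^sup>2)) + B / (1 + y\<^sup>2)"
      using mult_left_mono[OF B(1)[of y] abs_ge_zero[of L]] B(2)[of y]
      by (intro order_trans[OF norm_triangle_ineq4] add_mono) (simp_all only: norm_mult norm_of_real)
    also have "\<dots> = ((\<bar>L\<bar> + 1) * B) / (1 + y\<^sup>2)"
      by (simp add: add_divide_distrib algebra_simps)
    finally have "exp (L * s) * norm (of_real L * F (Complex s y) - F1 (Complex s y))
        \<le> exp (L * s) * (((\<bar>L\<bar> + 1) * B) / (1 + y\<^sup>2))"
      by (intro mult_left_mono) auto
    thus ?thesis by (simp add: f_def norm_mult)
  qed
  have intf': "integrable lborel (\<lambda>y. f' (Complex s y))"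
    unfolding f'_def by (intro Bochner_Integration.integrable_diff integrable_mult_right int0 int2)
  have "(CLBINT y. \<i> * f' (Complex s y)) = 0"
  proof (rule integral_deriv_eq_0)
    show "((\<lambda>y. f (Complex s y)) has_vector_derivative \<i> * f' (Complex s y)) (at y)" for y
      using s by (intro has_vector_derivative_vertical_line f) simp
    have "continuous_on {z. Re z > 0} f'"
      unfolding f'_def by (intro continuous_intros contF F2)
    thus "continuous_on UNIV (\<lambda>y. \<i> * f' (Complex s y))"
      using s by (intro continuous_intros continuous_on_vertical_line)
    show "integrable lborel (\<lambda>y. \<i> * f' (Complex s y))"
      by (intro integrable_mult_right intf')
    show "((\<lambda>y. f (Complex s y)) \<longlongrightarrow> 0) at_top" "((\<lambda>y. f (Complex s y)) \<longlongrightarrow> 0) at_bot"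
      by (rule Lim_null_comparison[where g = "\<lambda>y. (exp (L * s) * ((\<bar>L\<bar> + 1) * B)) / (1 + y\<^sup>2)"],
          rule always_eventually, rule allI, rule f_bd, rule inverse_one_plus_square_tendsto_0)+
  qed
  hence "(CLBINT y. f' (Complex s y)) = 0"
    by (simp only: integral_mult_right_zero) simp
  thus "of_real (L\<^sup>2) * (CLBINT y. exp (of_real L * Complex s y) * F (Complex s y)) =
         (CLBINT y. exp (of_real L * Complex s y) * F2 (Complex s y))"
    unfolding f'_def using int0 int2
    by (subst (asm) Bochner_Integration.integral_diff)
       (auto intro!: integrable_mult_right simp only: integral_mult_right_zero eq_iff_diff_eq_0[symmetric])
qed

section \<open>Absolute integrals of powers over vertical lines\<close>

lemma integrable_norm_line_powr:
  assumes a: "a > 1"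
  shows "integrable lborel (\<lambda>y. norm (Complex 1 y) powr - a)"
proof -
  define g where "g = (\<lambda>y::real. indicator {1..} y *\<^sub>R y powr - a)"
  have "set_integrable lborel {1..} (\<lambda>y::real. y powr - a)"
    unfolding set_integrable_def
    using nonnegative_absolutely_integrable_1[OF has_integral_integrable[OF has_integral_powr_to_inf[of "- a" 1]]] a
    by (subst integrable_completion[symmetric]) (auto simp: set_integrable_def)
  hence g: "integrable lborel g"
    by (simp add: set_integrable_def g_def)
  hence g': "integrable lborel (\<lambda>y. g (- y))"
    using lborel_integrable_real_affine[of g "-1" 0] by simp
  have i: "integrable lborel (\<lambda>y. indicator {-1..1::real} y :: real)"
    by simp
  show ?thesis
  proof (rule Bochner_Integration.integrable_bound[OF Bochner_Integration.integrable_add[OF Bochner_Integration.integrable_add[OF g g'] i]])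
    have "continuous_on UNIV (\<lambda>y. norm (Complex 1 y) powr - a)"
      by (intro continuous_intros) (auto simp: complex_eq_iff)
    thus "(\<lambda>y. norm (Complex 1 y) powr - a) \<in> borel_measurable lborel"
      using borel_measurable_continuous_onI by simp
    have "norm (Complex 1 y) powr - a \<le> g y + g (- y) + indicator {-1..1} y" for y
    proof -
      consider "y > 1" | "y < -1" | "y \<in> {-1..1}" by force
      thus ?thesis
      proof cases
        case 3
        have "norm (Complex 1 y) powr - a \<le> 1 powr - a"
          using a norm_Complex_ge(1)[of 1 y] by (intro powr_mono2') auto
        thus ?thesis using 3 by (auto simp: g_def indicator_def)
      next
        case 1
        have "norm (Complex 1 y) powr - a \<le> \<bar>y\<bar> powr - a"
          using a 1 norm_Complex_ge(2)[of y 1] by (intro powr_mono2') auto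
        thus ?thesis using 1 by (auto simp: g_def indicator_def)
      next
        case 2
        have "norm (Complex 1 y) powr - a \<le> \<bar>y\<bar> powr - a"
          using a 2 norm_Complex_ge(2)[of y 1] by (intro powr_mono2') auto
        thus ?thesis using 2 by (auto simp: g_def indicator_def)
      qed
    qed
    thus "AE y in lborel. norm (norm (Complex 1 y) powr - a) \<le> norm (g y + g (- y) + indicator {-1..1} y)"
      by (intro always_eventually allI) (metis abs_ge_self abs_of_nonneg order_trans powr_ge_zero real_norm_def)
  qed
qed

text \<open>The same rescaling as in \<open>exp_powr_line_scale\<close>, now for moduli. With
  exponent \<open>c + 1\<close> it produces the order \<open>L powr c\<close> of the error
  integral.\<close>

lemma norm_line_powr_scale:
  assumes a: "a > 1" and L: "L > 0"
  shows "integrable lborel (\<lambda>y. norm (Complex (1 / L) y) powr - a)"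
    and "(LBINT y. norm (Complex (1 / L) y) powr - a) = L powr (a - 1) * (LBINT y. norm (Complex 1 y) powr - a)"
proof -
  have eq: "norm (Complex (1 / L) (0 + 1 / L * y)) powr - a = L powr a * norm (Complex 1 y) powr - a" for y
  proof -
    have "Complex (1 / L) (0 + 1 / L * y) = of_real (1 / L) * Complex 1 y"
      using L by (simp add: complex_eq_iff)
    hence n: "norm (Complex (1 / L) (0 + 1 / L * y)) = norm (Complex 1 y) / L"
      using L by (simp add: norm_divide)
    show ?thesis
      unfolding n using L by (simp add: powr_divide powr_minus field_simps)
  qed
  have "integrable lborel (\<lambda>y. norm (Complex (1 / L) (0 + 1 / L * y)) powr - a)"
    unfolding eq using a by (intro integrable_mult_right integrable_norm_line_powr)
  thus "integrable lborel (\<lambda>y. norm (Complex (1 / L) y) powr - a)"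
    by (subst (asm) lborel_integrable_real_affine_iff) (use L in auto)
  have "(LBINT y. norm (Complex (1 / L) y) powr - a) = \<bar>1 / L\<bar> *\<^sub>R (LBINT y. L powr a * norm (Complex 1 y) powr - a)"
    by (subst lborel_integral_real_affine[of "1 / L" _ 0]) (use L in \<open>simp_all only: eq, simp_all\<close>)
  also have "\<dots> = L powr (a - 1) * (LBINT y. norm (Complex 1 y) powr - a)"
    using L by (simp add: powr_diff)
  finally show "(LBINT y. norm (Complex (1 / L) y) powr - a) = L powr (a - 1) * (LBINT y. norm (Complex 1 y) powr - a)" .
qed

text \<open>After two integrations by parts, \<open>L^2\<close> times the difference is exactly the
  integral of \<open>exp (L * z) * E z\<close> over \<open>Re z = 1 / L\<close>, where
  \<open>E\<close> is the second derivative of \<open>F\<close> without its leading term. The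
  condition \<open>L \<ge> 1\<close> keeps that line in the strip where the factor \<open>G\<close>
  is controlled.\<close>

lemma line_integral_estimate:
  assumes c: "c > 0"
  shows "\<exists>K. \<forall>L\<ge>1. norm ((CLBINT y. exp (of_real L * Complex 1 y) * Gamma_powr (Complex 1 y) c)
           - of_real (2 * pi * L powr (c - 1) / Gamma c)) \<le> K * L powr (c - 2)"
proof -
  define G where "G = (\<lambda>z. Gamma_powr (1 + z) c)"
  define G1 where "G1 = deriv G"
  define G2 where "G2 = deriv G1"
  obtain C where C: "C \<ge> 0" "\<And>k z. k \<le> 2 \<Longrightarrow> 0 \<le> Re z \<Longrightarrow> Re z \<le> 1 \<Longrightarrow> norm ((deriv ^^ k) G z) \<le> C / (1 + (Im z)\<^sup>2)"
    using Gamma_powr_Suc_deriv_bounds[OF c] unfolding G_def by blast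
  have bd: "norm (G (Complex x y)) \<le> C / (1 + y\<^sup>2)" "norm (G1 (Complex x y)) \<le> C / (1 + y\<^sup>2)"
    "norm (G2 (Complex x y)) \<le> C / (1 + y\<^sup>2)" if "0 \<le> x" "x \<le> 1" for x y
    using C(2)[of 0 "Complex x y"] C(2)[of 1 "Complex x y"] C(2)[of 2 "Complex x y"] that
    by (simp_all add: G1_def G2_def numeral_2_eq_2)
  have C_le: "C / (1 + y\<^sup>2) \<le> C" for y
    using frac_le[of C C 1 "1 + y\<^sup>2"] C(1) by simp
  have holG: "G holomorphic_on {z. Re z > -1}"
    unfolding G_def by (rule holomorphic_Gamma_powr_Suc)
  have holG1: "G1 holomorphic_on {z. Re z > -1}" and holG2: "G2 holomorphic_on {z. Re z > -1}"
    unfolding G1_def G2_def by (intro holomorphic_deriv holG open_halfspace_Re_gt)+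
  have dG: "(G has_field_derivative G1 z) (at z)" and dG1: "(G1 has_field_derivative G2 z) (at z)" if "Re z > 0" for z
    unfolding G1_def G2_def using holG holG1 that
    by (auto intro!: holomorphic_derivI[OF _ open_halfspace_Re_gt] simp: G1_def)
  define F where "F = (\<lambda>z. z powr - of_real c * G z)"
  define F1 where "F1 = (\<lambda>z. - of_real c * z powr - of_real (c + 1) * G z + z powr - of_real c * G1 z)"
  \<comment> \<open>These are the terms of the product rule, with the leading power of
    \<open>z\<close> removed. Replacing \<open>G z\<close> by \<open>G z - 1\<close> in the first
    term gains one power of \<open>z\<close>, since \<open>G\<close> equals 1 at 0.\<close>
  define E where "E = (\<lambda>z. of_real (c * (c + 1)) * z powr - of_real (c + 2) * (G z - 1)
     - of_real (2 * c) * z powr - of_real (c + 1) * G1 z + z powr - of_real c * G2 z)"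
  define F2 where "F2 = (\<lambda>z. of_real (c * (c + 1)) * z powr - of_real (c + 2) + E z)"
  have dpow: "((\<lambda>z. z powr - of_real a) has_field_derivative - of_real a * z powr - of_real (a + 1)) (at z)"
    if "Re z > 0" for a and z :: complex
    using that by (rule has_field_derivative_powr_minus)
  have dF: "(F has_field_derivative F1 z) (at z)" if "Re z > 0" for z
    unfolding F_def F1_def using DERIV_mult[OF dpow[OF that, of c] dG[OF that]] by (simp add: mult_ac add_ac)
  have dF1: "(F1 has_field_derivative F2 z) (at z)" if "Re z > 0" for z
  proof -
    have "((\<lambda>z. - of_real c * (z powr - of_real (c + 1) * G z) + z powr - of_real c * G1 z) has_field_derivative
       (- of_real c * (- of_real (c + 1) * z powr - of_real (c + 1 + 1) * G z + G1 z * z powr - of_real (c + 1))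
        + (- of_real c * z powr - of_real (c + 1) * G1 z + G2 z * z powr - of_real c))) (at z)"
      by (intro DERIV_add DERIV_cmult DERIV_mult dpow dG dG1 that)
    moreover have "- of_real c * (- of_real (c + 1) * z powr - of_real (c + 1 + 1) * G z + G1 z * z powr - of_real (c + 1))
        + (- of_real c * z powr - of_real (c + 1) * G1 z + G2 z * z powr - of_real c) = F2 z"
    proof -
      have "c + 1 + 1 = c + 2" by simp
      thus ?thesis by (simp only: F2_def E_def of_real_mult of_real_numeral) algebra
    qed
    ultimately show ?thesis by (simp only: F1_def mult.assoc)
  qed
  have contF2: "continuous_on {z. Re z > 0} F2"
    unfolding F2_def E_def
    by (intro continuous_intros holomorphic_on_imp_continuous_on holomorphic_powr_right_half_plane
        holomorphic_on_subset[OF holG] holomorphic_on_subset[OF holG1] holomorphic_on_subset[OF holG2]) auto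
  have contE: "continuous_on {z. Re z > 0} E"
    unfolding E_def
    by (intro continuous_intros holomorphic_on_imp_continuous_on holomorphic_powr_right_half_plane
        holomorphic_on_subset[OF holG] holomorphic_on_subset[OF holG1] holomorphic_on_subset[OF holG2]) auto
  have holF: "F holomorphic_on {z. Re z > 0}"
    unfolding F_def
    by (intro holomorphic_intros holomorphic_powr_right_half_plane holomorphic_on_subset[OF holG]) auto
  have Gamma_eq: "Gamma_powr z c = F z" if "Re z > 0" for z
    using Gamma_powr_eq[OF that] by (simp add: F_def G_def)
  define A where "A = (c * (c + 1) + 2 * c + 2) * C"
  have E_le: "norm (E z) \<le> A * norm z powr - (c + 1)" if z: "0 < Re z" "Re z \<le> 1" for z
  proof -
    obtain x y where zxy: "z = Complex x y" by (cases z)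
    have x: "0 < x" "x \<le> 1" using z zxy by auto
    have z0: "norm z > 0" using z by auto
    have p: "norm z powr - c = norm z * norm z powr - (c + 1)" "norm z powr - (c + 1) = norm z * norm z powr - (c + 2)"
      using z0 powr_add[of "norm z" 1 "- (c + 1)"] powr_add[of "norm z" 1 "- (c + 2)"]
      by (simp_all add: algebra_simps)
    have "norm (G z - 1) \<le> C * norm z"
      unfolding G_def
    proof (rule Gamma_powr_Suc_diff_bound)
      fix w assume w: "0 \<le> Re w" "Re w \<le> 1"
      show "norm (deriv (\<lambda>z. Gamma_powr (1 + z) c) w) \<le> C"
        using order_trans[OF bd(2)[of "Re w" "Im w"] C_le] w by (simp add: G1_def G_def)
    qed (use z in auto)
    hence 1: "c * (c + 1) * norm z powr - (c + 2) * norm (G z - 1) \<le> c * (c + 1) * C * norm z powr - (c + 1)"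
      using mult_left_mono[of "norm (G z - 1)" "C * norm z" "c * (c + 1) * norm z powr - (c + 2)"] c
      unfolding p(2) by (simp add: mult_ac)
    have "norm (G1 z) \<le> C"
      using order_trans[OF bd(2)[of x y] C_le] x by (simp add: zxy)
    hence 2: "2 * c * norm z powr - (c + 1) * norm (G1 z) \<le> 2 * c * C * norm z powr - (c + 1)"
      using mult_left_mono[of "norm (G1 z)" C "2 * c * norm z powr - (c + 1)"] c by (simp add: mult_ac)
    \<comment> \<open>For large \<open>z\<close> the factor \<open>z powr -c\<close> alone is larger
      than the required \<open>norm z powr -(c + 1)\<close>. The missing factor
      \<open>norm z\<close> is absorbed by the decay of \<open>G2\<close>.\<close>
    have "norm z \<le> 1 + \<bar>y\<bar>"
      using cmod_le[of z] x by (simp add: zxy)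
    also have "\<dots> \<le> 2 * (1 + y\<^sup>2)"
    proof -
      have "2 * \<bar>y\<bar> \<le> y\<^sup>2 + 1"
        using sum_squares_bound[of "\<bar>y\<bar>" 1] by simp
      thus ?thesis using zero_le_power2[of y] by argo
    qed
    finally have "norm z * norm (G2 z) \<le> 2 * (1 + y\<^sup>2) * (C / (1 + y\<^sup>2))"
      using bd(3)[of x y] x by (intro mult_mono) (auto simp: zxy)
    also have "\<dots> = 2 * C"
    proof -
      have "1 + y\<^sup>2 \<noteq> 0" using zero_le_power2[of y] by linarith
      thus ?thesis by (simp del: distrib_left_numeral)
    qed
    finally have 3: "norm z powr - c * norm (G2 z) \<le> 2 * C * norm z powr - (c + 1)"
      using mult_left_mono[of "norm z * norm (G2 z)" "2 * C" "norm z powr - (c + 1)"]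
      unfolding p(1) by (simp add: mult_ac)
    have "norm (E z) \<le> norm (of_real (c * (c + 1)) * z powr - of_real (c + 2) * (G z - 1))
        + norm (of_real (2 * c) * z powr - of_real (c + 1) * G1 z) + norm (z powr - of_real c * G2 z)"
      unfolding E_def by (intro order_trans[OF norm_triangle_ineq] add_mono norm_triangle_ineq4 order_refl)
    also have "\<dots> = c * (c + 1) * norm z powr - (c + 2) * norm (G z - 1)
        + 2 * c * norm z powr - (c + 1) * norm (G1 z) + norm z powr - c * norm (G2 z)"
      using c by (simp only: norm_mult norm_powr_minus norm_of_real) simp
    also have "\<dots> \<le> A * norm z powr - (c + 1)"
      using 1 2 3 by (simp add: A_def algebra_simps)
    finally show ?thesis .
  qed
  define M where "M = (LBINT y. norm (Complex 1 y) powr - (c + 1))"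
  have "norm ((CLBINT y. exp (of_real L * Complex 1 y) * Gamma_powr (Complex 1 y) c)
           - of_real (2 * pi * L powr (c - 1) / Gamma c)) \<le> exp 1 * A * M * L powr (c - 2)"
    if L: "L \<ge> 1" for L
  proof -
    \<comment> \<open>On this line \<open>exp (L * z)\<close> has modulus \<open>exp 1\<close>,
      whatever \<open>L\<close> is.\<close>
    define s where "s = 1 / L"
    have s: "0 < s" "s \<le> 1" using L by (auto simp: s_def)
    have pow_le: "norm (z powr - complex_of_real a) \<le> s powr - a" if "s \<le> Re z" "a \<ge> 0" for z a
      using that s complex_Re_le_cmod[of z] by (intro norm_powr_minus_le) auto
    have F_le: "norm (F (Complex x y)) \<le> (s powr - c * C) / (1 + y\<^sup>2)" if "s \<le> x" "x \<le> 1" for x y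
      using mult_mono[OF pow_le[of "Complex x y" c] bd(1)[of x y]] that s c by (simp add: F_def norm_mult)
    have "(CLBINT y. exp (of_real L * Complex 1 y) * Gamma_powr (Complex 1 y) c)
        = (CLBINT y. exp (of_real L * Complex 1 y) * F (Complex 1 y))"
      by (simp add: Gamma_eq)
    also have "\<dots> = (CLBINT y. exp (of_real L * Complex s y) * F (Complex s y))"
    proof (rule integral_vertical_line_shift[symmetric])
      show "(\<lambda>z. exp (of_real L * z) * F z) holomorphic_on {z. Re z > 0}"
        by (intro holomorphic_intros holF)
      fix x y assume x: "s \<le> x" "x \<le> 1"
      have "norm (exp (of_real L * Complex x y) * F (Complex x y)) \<le> exp L * ((s powr - c * C) / (1 + y\<^sup>2))"
        unfolding norm_mult using x L s by (intro mult_mono F_le) (auto simp: mult_left_le)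
      thus "norm (exp (of_real L * Complex x y) * F (Complex x y)) \<le> (exp L * (s powr - c * C)) / (1 + y\<^sup>2)"
        by simp
    qed (use s in auto)
    finally have shift: "(CLBINT y. exp (of_real L * Complex 1 y) * Gamma_powr (Complex 1 y) c)
        = (CLBINT y. exp (of_real L * Complex s y) * F (Complex s y))" .
    \<comment> \<open>This bound depends on \<open>L\<close> through \<open>s\<close>. It serves
      only integrability and the vanishing of the boundary terms, and does not enter the final
      constant.\<close>
    define B where "B = s powr - c * C + 2 * c * (s powr - (c + 1) * C) + c * (c + 1) * (s powr - (c + 2) * C)"
    have term_le: "norm (Complex s y powr - of_real a * H) \<le> s powr - a * C / (1 + y\<^sup>2)"
      if "norm H \<le> C / (1 + y\<^sup>2)" "a \<ge> 0" for a y H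
      using mult_mono[OF pow_le[of "Complex s y" a] that(1)] that(2) by (simp add: norm_mult)
    have nonneg: "0 \<le> s powr - a * C / (1 + y\<^sup>2)" for a y
      using C(1) by (intro divide_nonneg_nonneg mult_nonneg_nonneg) auto
    have B_eq: "B / (1 + y\<^sup>2) = s powr - c * C / (1 + y\<^sup>2) + 2 * (c * (s powr - (c + 1) * C / (1 + y\<^sup>2)))
        + c * (c + 1) * (s powr - (c + 2) * C / (1 + y\<^sup>2))" for y
      by (simp add: B_def add_divide_distrib)
    have FB: "norm (F (Complex s y)) \<le> B / (1 + y\<^sup>2)" for y
    proof -
      have "norm (F (Complex s y)) \<le> s powr - c * C / (1 + y\<^sup>2)"
        unfolding F_def using s c by (intro term_le bd) auto
      moreover have "0 \<le> c * (s powr - (c + 1) * C / (1 + y\<^sup>2))"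
        "0 \<le> c * (c + 1) * (s powr - (c + 2) * C / (1 + y\<^sup>2))"
        using c by (intro mult_nonneg_nonneg nonneg; simp)+
      ultimately show ?thesis unfolding B_eq by linarith
    qed
    have F1B: "norm (F1 (Complex s y)) \<le> B / (1 + y\<^sup>2)" for y
    proof -
      let ?z = "Complex s y"
      have "norm (F1 ?z) \<le> c * norm (?z powr - of_real (c + 1) * G ?z) + norm (?z powr - of_real c * G1 ?z)"
        unfolding F1_def using c by (intro order_trans[OF norm_triangle_ineq]) (simp add: norm_mult)
      also have "\<dots> \<le> c * (s powr - (c + 1) * C / (1 + y\<^sup>2)) + s powr - c * C / (1 + y\<^sup>2)"
        using s c by (intro add_mono mult_left_mono term_le bd) auto
      also have "\<dots> \<le> B / (1 + y\<^sup>2)"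
      proof -
        have nn: "0 \<le> c * (s powr - (c + 1) * C / (1 + y\<^sup>2))"
          "0 \<le> c * (c + 1) * (s powr - (c + 2) * C / (1 + y\<^sup>2))"
          using c by (intro mult_nonneg_nonneg nonneg; simp)+
        have "t1 + t0 \<le> t0 + 2 * t1 + t2" if "0 \<le> t1" "0 \<le> t2" for t0 t1 t2 :: real
          using that by simp
        from this[OF nn] show ?thesis unfolding B_eq .
      qed
      finally show ?thesis .
    qed
    have F2B: "norm (F2 (Complex s y)) \<le> B / (1 + y\<^sup>2)" for y
    proof -
      let ?z = "Complex s y"
      have "F2 ?z = of_real (c * (c + 1)) * (?z powr - of_real (c + 2) * G ?z)
          - of_real (2 * c) * (?z powr - of_real (c + 1) * G1 ?z) + ?z powr - of_real c * G2 ?z"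
        by (simp add: F2_def E_def algebra_simps)
      hence "norm (F2 ?z) \<le> norm (of_real (c * (c + 1)) * (?z powr - of_real (c + 2) * G ?z))
          + norm (of_real (2 * c) * (?z powr - of_real (c + 1) * G1 ?z)) + norm (?z powr - of_real c * G2 ?z)"
        by (simp only:) (intro order_trans[OF norm_triangle_ineq] add_mono norm_triangle_ineq4 order_refl)
      also have "\<dots> = c * (c + 1) * norm (?z powr - of_real (c + 2) * G ?z)
          + 2 * c * norm (?z powr - of_real (c + 1) * G1 ?z) + norm (?z powr - of_real c * G2 ?z)"
        using c by (simp only: norm_mult[of "of_real _"] norm_of_real) simp
      also have "\<dots> \<le> c * (c + 1) * (s powr - (c + 2) * C / (1 + y\<^sup>2))
          + 2 * c * (s powr - (c + 1) * C / (1 + y\<^sup>2)) + s powr - c * C / (1 + y\<^sup>2)"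
        using s c by (intro add_mono mult_left_mono term_le bd) auto
      finally show ?thesis unfolding B_eq mult.assoc by linarith
    qed
    have parts: "of_real (L\<^sup>2) * (CLBINT y. exp (of_real L * Complex s y) * F (Complex s y)) =
         (CLBINT y. exp (of_real L * Complex s y) * F2 (Complex s y))"
      by (rule integral_exp_line_by_parts[OF s(1) dF dF1 contF2 FB F1B F2B])
    have norm_exp_E: "norm (exp (of_real L * Complex s y) * E (Complex s y))
        \<le> exp 1 * A * norm (Complex s y) powr - (c + 1)" for y
      using mult_left_mono[OF E_le[of "Complex s y"], of "exp 1"] s L
      by (simp add: norm_mult s_def mult_ac)
    have int_bound: "integrable lborel (\<lambda>y. exp 1 * A * norm (Complex s y) powr - (c + 1))"
      unfolding s_def using c L by (intro integrable_mult_right norm_line_powr_scale) auto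
    have intE: "integrable lborel (\<lambda>y. exp (of_real L * Complex s y) * E (Complex s y))"
    proof (rule integrable_if_dominated[OF _ int_bound norm_exp_E])
      show "continuous_on UNIV (\<lambda>y. exp (of_real L * Complex s y) * E (Complex s y))"
        using s contE by (intro continuous_on_vertical_line[of "\<lambda>z. exp (of_real L * z) * E z"] continuous_intros)
    qed
    have Gam: "Gamma (c + 2) = c * (c + 1) * Gamma c"
    proof -
      have "c \<notin> \<int>\<^sub>\<le>\<^sub>0" "c + 1 \<notin> \<int>\<^sub>\<le>\<^sub>0"
        using c by (auto dest: nonpos_Ints_nonpos)
      thus ?thesis
        using Gamma_plus1[of c] Gamma_plus1[of "c + 1"] by (simp add: add.assoc)
    qed
    have Gam_pos: "Gamma c > 0" using c by simp
    have "(CLBINT y. exp (of_real L * Complex s y) * F2 (Complex s y)) =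
        (CLBINT y. of_real (c * (c + 1)) * (exp (of_real L * Complex s y) * Complex s y powr - of_real (c + 2))
           + exp (of_real L * Complex s y) * E (Complex s y))"
      by (rule Bochner_Integration.integral_cong) (simp_all add: F2_def algebra_simps)
    also have "\<dots> = of_real (c * (c + 1)) * (CLBINT y. exp (of_real L * Complex s y) * Complex s y powr - of_real (c + 2))
           + (CLBINT y. exp (of_real L * Complex s y) * E (Complex s y))"
      using c s
      by (subst Bochner_Integration.integral_add[OF integrable_mult_right[OF integrable_exp_powr_line] intE])
         (simp, simp, simp only: integral_mult_right_zero)
    also have "(CLBINT y. exp (of_real L * Complex s y) * Complex s y powr - of_real (c + 2))
        = of_real (2 * pi * L powr (c + 2 - 1) / Gamma (c + 2))"
      unfolding s_def using c L by (intro exp_powr_line) auto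
    \<comment> \<open>The factor \<open>c * (c + 1)\<close> from differentiating the power cancels
      against the one in \<open>Gamma (c + 2)\<close>, which leaves exactly \<open>L^2\<close> times
      the expected main term.\<close>
    also have "of_real (c * (c + 1)) * complex_of_real (2 * pi * L powr (c + 2 - 1) / Gamma (c + 2))
        = of_real (L\<^sup>2) * of_real (2 * pi * L powr (c - 1) / Gamma c)"
    proof -
      have "L powr (c + 2 - 1) = L\<^sup>2 * L powr (c - 1)"
        using L powr_add[of L 2 "c - 1"] by (simp add: algebra_simps)
      hence "c * (c + 1) * (2 * pi * L powr (c + 2 - 1) / Gamma (c + 2)) = L\<^sup>2 * (2 * pi * L powr (c - 1) / Gamma c)"
        using c Gam_pos by (simp add: Gam)
      thus ?thesis by (simp only: of_real_mult[symmetric])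
    qed
    finally have "of_real (L\<^sup>2) * ((CLBINT y. exp (of_real L * Complex 1 y) * Gamma_powr (Complex 1 y) c)
        - of_real (2 * pi * L powr (c - 1) / Gamma c)) = (CLBINT y. exp (of_real L * Complex s y) * E (Complex s y))"
      using parts unfolding shift right_diff_distrib by simp
    from arg_cong[where f = norm, OF this]
    have "L\<^sup>2 * norm ((CLBINT y. exp (of_real L * Complex 1 y) * Gamma_powr (Complex 1 y) c)
        - of_real (2 * pi * L powr (c - 1) / Gamma c)) = norm (CLBINT y. exp (of_real L * Complex s y) * E (Complex s y))"
      by (simp only: norm_mult norm_of_real abs_power2)
    also have "\<dots> \<le> (LBINT y. exp 1 * A * norm (Complex s y) powr - (c + 1))"
      by (intro Bochner_Integration.integral_norm_bound_integral intE int_bound norm_exp_E)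
    also have "\<dots> = exp 1 * A * (L powr (c + 1 - 1) * M)"
      unfolding s_def M_def using c L norm_line_powr_scale(2)[of "c + 1" L]
      by (simp only: integral_mult_right_zero)
    \<comment> \<open>The error integral has order \<open>L powr c\<close>; splitting off
      \<open>L^2\<close> allows division by the factor from the integration by parts.\<close>
    also have "L powr (c + 1 - 1) = L\<^sup>2 * L powr (c - 2)"
      using L powr_add[of L 2 "c - 2"] by simp
    also have "exp 1 * A * (L\<^sup>2 * L powr (c - 2) * M) = L\<^sup>2 * (exp 1 * A * M * L powr (c - 2))"
      by (simp only: mult_ac)
    finally show ?thesis
      using L by simp
  qed
  thus ?thesis by blast
qed

theorem theorem2p4:
  fixes c :: real
  assumes "c > 0"
  shows "(\<lambda>t. e_fun c t - ln (1 / t) powr (c - 1) / Gamma c)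
           \<in> O[at_right 0](\<lambda>t. ln (1 / t) powr (c - 2))"
proof -
  obtain K where K: "\<And>L. L \<ge> 1 \<Longrightarrow>
      norm ((CLBINT y. exp (of_real L * Complex 1 y) * Gamma_powr (Complex 1 y) c)
        - of_real (2 * pi * L powr (c - 1) / Gamma c)) \<le> K * L powr (c - 2)"
    using line_integral_estimate[OF assms] by blast
  \<comment> \<open>The threshold \<open>exp (- 1)\<close> is the point where
    \<open>ln (1 / t) = 1\<close>, so that the estimate for \<open>L \<ge> 1\<close>
    applies.\<close>
  have "norm (e_fun c t - ln (1 / t) powr (c - 1) / Gamma c) \<le> K / (2 * pi) * norm (ln (1 / t) powr (c - 2))"
    if t: "0 < t" "t < exp (- 1)" for t
  proof -
    define L where "L = ln (1 / t)"
    have "ln t < - 1"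
      using t ln_less_cancel_iff[of t "exp (- 1)"] by simp
    hence L: "L \<ge> 1"
      using t by (simp add: L_def ln_div)
    define J where "J = (CLBINT y. exp (of_real L * Complex 1 y) * Gamma_powr (Complex 1 y) c)"
    have "complex_of_real (e_fun c t - L powr (c - 1) / Gamma c) =
        (J - of_real (2 * pi * L powr (c - 1) / Gamma c)) / of_real (2 * pi)"
      using e_fun_eq_line_integral[OF t(1), of c] unfolding L_def[symmetric] J_def[symmetric]
      by (simp add: diff_divide_distrib)
    hence "norm (e_fun c t - L powr (c - 1) / Gamma c) =
        norm (J - of_real (2 * pi * L powr (c - 1) / Gamma c)) / (2 * pi)"
      by (metis norm_divide norm_of_real abs_of_pos real_norm_def pi_gt_zero zero_less_mult_iff zero_less_numeral)
    also have "\<dots> \<le> K * L powr (c - 2) / (2 * pi)"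
      using K[OF L] unfolding J_def[symmetric] by (intro divide_right_mono) auto
    finally show ?thesis
      by (simp add: L_def)
  qed
  moreover have "\<forall>\<^sub>F t in at_right 0. 0 < t \<and> t < exp (- 1 :: real)"
    by (intro eventually_conj eventually_at_right_less eventually_at_right_real[THEN eventually_mono]) auto
  ultimately show ?thesis
    by (intro bigoI[of _ "K / (2 * pi)"]) (auto elim!: eventually_mono)
qed

end
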